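(* Let $0<\beta\le 1$. Let $y=(y(t_* ))_{t_*\ge 0}$ be a standard Poisson process (intensity $1$), let $(t(t_* ))_{t_*\ge 0}$ be a $\beta$-stable subordinator normalized by $\mathbb{E}[e^{-s\,t(t_* )}]=e^{-t_* s^\beta}$ for all $s\ge 0$, $t_*\ge0$, independent of $y$, and let $(t_*(t))_{t\ge 0}$ be its inverse process (the inverse stable subordinator of order $\beta$). Let $x=(x(t))_{t\ge 0}$, $x(t)=N_\beta(t)$, be the $\beta$-fractional Poisson process. Then $$x(t)=y(t_*(t)),\qquad t\ge 0,$$ as an equality in law of stochastic processes; that is, the fractional Poisson process is obtained from the standard Poisson process by time change via the inverse stable subordinator.
   Context: The $\beta$-fractional Poisson process $N_\beta$ ($0<\beta\le 1$) is the counting process $N_\beta(t)=\max\{n\ge 0: t_n\le t\}$ of a renewal process $0=t_0<t_1<t_2<\cdots$ with i.i.d. positive waiting times $T_j=t_j-t_{j-1}$, $j\ge1$, satisfying $P(T_j>t)=E_\beta(-t^\beta)$ for $t\ge 0$. Here $E_\beta(z)=\sum_{n=0}^\infty \frac{z^n}{\Gamma(\beta n+1)}$ is the Mittag-Leffler function. For $\beta=1$ this is the standard Poisson process $N_1$. A $\beta$-stable subordinator is a nondecreasing Lévy process started at $0$ with the indicated Laplace transform, taken with càdlàg paths (for $\beta=1$ it is $t(t_* )=t_*$). Its inverse process is $t_*(t)=\inf\{\tau\ge 0: t(\tau)>t\}$, $t\ge 0$. The variable $t$ is natural time and $t_*$ is operational time. *)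

theory Defs
  imports "HOL-Probability.Probability"
begin

definition mittag_leffler :: "real \<Rightarrow> real \<Rightarrow> real" where
  "mittag_leffler \<beta> z = (\<Sum>n. z ^ n / Gamma (\<beta> * real n + 1))"

(* For nonnegative t the set contains 0.  For the waiting times used below it is almost surely
   finite for all t at once; where it is infinite, Max is a fixed unspecified number. *)
definition renewal_count :: "(nat \<Rightarrow> 'a \<Rightarrow> real) \<Rightarrow> real \<Rightarrow> 'a \<Rightarrow> nat" where
  "renewal_count T t \<omega> = Max {n. (\<Sum>j=1..n. T j \<omega>) \<le> t}"

(* The level t is almost surely exceeded by an unbounded path.  The value 0 on the remaining
   null set replaces the infimum of the empty set, so that the result is always a valid time. *)
definition inverse_process :: "(real \<Rightarrow> 'a \<Rightarrow> real) \<Rightarrow> real \<Rightarrow> 'a \<Rightarrow> real" where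
  "inverse_process D t \<omega> =
     (if {\<tau>. 0 \<le> \<tau> \<and> D \<tau> \<omega> > t} = {} then 0 else Inf {\<tau>. 0 \<le> \<tau> \<and> D \<tau> \<omega> > t})"

definition cadlag_path :: "(real \<Rightarrow> real) \<Rightarrow> bool" where
  "cadlag_path f \<longleftrightarrow>
     (\<forall>t\<ge>0. (f \<longlongrightarrow> f t) (at_right t)) \<and> (\<forall>t>0. \<exists>l. (f \<longlongrightarrow> l) (at_left t))"

definition path_of :: "(real \<Rightarrow> 'a \<Rightarrow> 'c) \<Rightarrow> 'a \<Rightarrow> real \<Rightarrow> 'c" where
  "path_of X \<omega> = (\<lambda>t\<in>{0..}. X t \<omega>)"

abbreviation path_space :: "'c measure \<Rightarrow> (real \<Rightarrow> 'c) measure" where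
  "path_space S \<equiv> (\<Pi>\<^sub>M t\<in>{0..}. S)"

(* Laws are compared on the product sigma-algebra, that is, through all finite-dimensional
   distributions.  Measurability is demanded because distr is meaningful only for measurable maps. *)
definition equal_in_law ::
  "'c measure \<Rightarrow> 'a measure \<Rightarrow> (real \<Rightarrow> 'a \<Rightarrow> 'c) \<Rightarrow> 'b measure \<Rightarrow> (real \<Rightarrow> 'b \<Rightarrow> 'c) \<Rightarrow> bool" where
  "equal_in_law S M X M' Y \<longleftrightarrow>
     (\<forall>t\<ge>0. X t \<in> measurable M S) \<and> (\<forall>t\<ge>0. Y t \<in> measurable M' S) \<and>
     distr M (path_space S) (path_of X) = distr M' (path_space S) (path_of Y)"

context prob_space
begin

definition renewal_counting_process :: "(real \<Rightarrow> real) \<Rightarrow> (real \<Rightarrow> 'a \<Rightarrow> nat) \<Rightarrow> bool" where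
  "renewal_counting_process survival N \<longleftrightarrow>
     (\<exists>T. indep_vars (\<lambda>_. borel) T {1..} \<and>
          (\<forall>j\<ge>1. AE \<omega> in M. T j \<omega> > 0) \<and>
          (\<forall>j\<ge>1. \<forall>t\<ge>0. prob {\<omega> \<in> space M. T j \<omega> > t} = survival t) \<and>
          (\<forall>t\<ge>0. \<forall>\<omega>\<in>space M. N t \<omega> = renewal_count T t \<omega>))"

definition fractional_poisson_process :: "real \<Rightarrow> (real \<Rightarrow> 'a \<Rightarrow> nat) \<Rightarrow> bool" where
  "fractional_poisson_process \<beta> =
     renewal_counting_process (\<lambda>t. mittag_leffler \<beta> (- (t powr \<beta>)))"

definition standard_poisson_process :: "(real \<Rightarrow> 'a \<Rightarrow> nat) \<Rightarrow> bool" where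
  "standard_poisson_process = renewal_counting_process (\<lambda>t. exp (- t))"

definition levy_process :: "(real \<Rightarrow> 'a \<Rightarrow> real) \<Rightarrow> bool" where
  "levy_process X \<longleftrightarrow>
     (\<forall>t\<ge>0. random_variable borel (X t)) \<and>
     (AE \<omega> in M. X 0 \<omega> = 0) \<and>
     (\<forall>n t. 0 \<le> t 0 \<and> (\<forall>i<n. t i < t (Suc i)) \<longrightarrow>
        indep_vars (\<lambda>_. borel) (\<lambda>i \<omega>. X (t (Suc i)) \<omega> - X (t i) \<omega>) {..<n::nat}) \<and>
     (\<forall>s\<ge>0. \<forall>h\<ge>0. distr M borel (\<lambda>\<omega>. X (s + h) \<omega> - X s \<omega>) = distr M borel (X h)) \<and>
     (\<forall>s\<ge>0. \<forall>\<epsilon>>0.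
        ((\<lambda>t. prob {\<omega> \<in> space M. \<bar>X t \<omega> - X s \<omega>\<bar> > \<epsilon>}) \<longlongrightarrow> 0) (at s within {0..}))"

definition stable_subordinator :: "real \<Rightarrow> (real \<Rightarrow> 'a \<Rightarrow> real) \<Rightarrow> bool" where
  "stable_subordinator \<beta> D \<longleftrightarrow>
     levy_process D \<and>
     (\<forall>\<omega>\<in>space M. cadlag_path (\<lambda>\<tau>. D \<tau> \<omega>) \<and> mono_on {0..} (\<lambda>\<tau>. D \<tau> \<omega>)) \<and>
     (\<forall>s\<ge>0. \<forall>\<tau>\<ge>0. expectation (\<lambda>\<omega>. exp (- s * D \<tau> \<omega>)) = exp (- \<tau> * s powr \<beta>))"

(* This is indep_var for the two path maps; indep_var itself needs equal value types. *)
definition independent_processes ::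
  "'c measure \<Rightarrow> (real \<Rightarrow> 'a \<Rightarrow> 'c) \<Rightarrow> 'd measure \<Rightarrow> (real \<Rightarrow> 'a \<Rightarrow> 'd) \<Rightarrow> bool" where
  "independent_processes S X S' Y \<longleftrightarrow>
     random_variable (path_space S) (path_of X) \<and> random_variable (path_space S') (path_of Y) \<and>
     indep_set {path_of X -` A \<inter> space M | A. A \<in> sets (path_space S)}
               {path_of Y -` B \<inter> space M | B. B \<in> sets (path_space S')}"

end

lemma mittag_leffler_1: "mittag_leffler 1 z = exp z"
  by (simp add: mittag_leffler_def exp_def Gamma_fact add.commute scaleR_conv_of_real divide_inverse mult.commute)

lemma (in prob_space) fractional_poisson_process_1:
  "fractional_poisson_process 1 N \<longleftrightarrow> standard_poisson_process N"
  unfolding fractional_poisson_process_def standard_poisson_process_def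
    renewal_counting_process_def
  by (simp add: mittag_leffler_1 cong: conj_cong)

end

(* Let S_n be the renewal epochs of y, with unit exponential waiting times U_n.  Since the
   subordinator D almost surely does not jump at S_n, the events S_n <= t_*(t) and D(S_n) <= t
   agree for all n and t at once, so y(t_*(t)) is the renewal counting process with waiting times
   W_n = D(S_n) - D(S_{n-1}).  Conditionally on y, the W_n are independent and W_n is distributed
   like D(U_n); mixing over the independent U_n shows that the W_n are independent with Laplace
   transform E exp(-U l^beta) = 1/(1 + l^beta).  Termwise integration of the Mittag-Leffler series
   gives the same transform for the waiting times of the fractional Poisson process when l > 1,
   and this range of l already determines the law. *)
theory Submission imports Defs begin

text \<open>Independence of \<open>y\<close> and \<open>D\<close> is a statement about two path maps
  into product sigma-algebras, and a measurable set there depends on only countably many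
  coordinates. Conditioning on \<open>y\<close> is done by Fubini: the expectation of a functional
  of both paths becomes an iterated integral in which the path of \<open>y\<close> is frozen. Every
  object involved must therefore be a jointly measurable functional of the pair of paths. This is
  why the epochs are recovered from rational values of \<open>y\<close>, and the value of
  \<open>D\<close> at an epoch as a limit along grid times. Once the epochs are frozen, they are
  deterministic times, where the Levy property gives independent stationary increments and
  stochastic continuity excludes a jump. The restriction l > 1 is the range in which the series of
  absolute values has a finite integral; transforms at l = 2, 4, 6, ... are already the moments of a
  bounded variable, which determine its law.\<close>

section \<open>Laplace transforms and the Mittag-Leffler law\<close>

text \<open>The hypothesis says that the bounded variables \<open>exp (- c X)\<close> have the same moments, hence the
  same characteristic function.\<close>

lemma laplace_transform_unique:
  fixes M1 M2 :: "real measure"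
  assumes "real_distribution M1" "real_distribution M2"
    and "AE x in M1. 0 \<le> x" "AE x in M2. 0 \<le> x" and c: "c > 0"
    and eq: "\<And>k::nat. (\<integral>x. exp (- (c * real k * x)) \<partial>M1) = (\<integral>x. exp (- (c * real k * x)) \<partial>M2)"
  shows "M1 = M2"
proof -
  define g :: "real \<Rightarrow> real" where "g x = exp (- (c * x))" for x
  have [measurable]: "g \<in> borel_measurable borel"
    unfolding g_def by measurable
  have gp: "g x ^ k = exp (- (c * real k * x))" for x k
    unfolding g_def by (simp add: exp_of_nat_mult[symmetric] mult_ac)
  \<comment> \<open>Almost surely 0 < \<open>g\<close> <= 1, so the Taylor error of the
    characteristic function is at most 2 |t|^n / n!. It vanishes in the limit for every t, and thus
    the moments fix the characteristic function.\<close>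
  have approx: "cmod (char (distr N borel g) t
      - (\<Sum>k\<le>n. ((\<i> * t) ^ k / fact k) * (\<integral>x. exp (- (c * real k * x)) \<partial>N))) \<le> 2 * \<bar>t\<bar> ^ n / fact n"
    if N: "real_distribution N" and nonneg: "AE x in N. 0 \<le> x" for N t n
  proof -
    interpret real_distribution N by fact
    have bd: "AE x in N. norm (g x ^ k) \<le> 1" for k
      using nonneg by eventually_elim (use c in \<open>simp add: gp\<close>)
    have int: "integrable N (\<lambda>x. g x ^ k)" for k
      by (rule integrable_const_bound[OF bd]) simp
    have "cmod (char (distr N borel g) t
      - (\<Sum>k\<le>n. ((\<i> * t) ^ k / fact k) * expectation (\<lambda>x. g x ^ k)))
        \<le> (2 * \<bar>t\<bar> ^ n / fact n) * expectation (\<lambda>x. \<bar>g x\<bar> ^ n)"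
      by (rule char_approx1') (use int in auto)
    also have "\<dots> \<le> (2 * \<bar>t\<bar> ^ n / fact n) * 1"
    proof (rule mult_left_mono)
      have "expectation (\<lambda>x. \<bar>g x\<bar> ^ n) \<le> expectation (\<lambda>_. 1)"
      proof (rule integral_mono_AE)
        show "integrable N (\<lambda>x. \<bar>g x\<bar> ^ n)"
          using integrable_norm[OF int[of n]] by (simp add: power_abs)
      qed (use bd[of n] in \<open>auto simp: power_abs\<close>)
      then show "expectation (\<lambda>x. \<bar>g x\<bar> ^ n) \<le> 1"
        using prob_space by simp
    qed simp
    finally show ?thesis
      by (simp add: gp)
  qed
  have "char (distr M1 borel g) t = char (distr M2 borel g) t" for t
  proof -
    define u where "u n = (\<Sum>k\<le>n. ((\<i> * t) ^ k / fact k) * complex_of_real (\<integral>x. exp (- (c * real k * x)) \<partial>M1))" for n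
    have lim: "(\<lambda>n. 2 * \<bar>t\<bar> ^ n / fact n) \<longlonglongrightarrow> 0"
      using tendsto_mult_left[OF summable_LIMSEQ_zero[OF summable_exp[of "\<bar>t\<bar>"]], of 2]
      by (simp add: field_simps)
    have "(\<lambda>n. u n - char (distr M1 borel g) t) \<longlonglongrightarrow> 0"
      by (rule Lim_null_comparison[OF _ lim])
         (use approx[OF assms(1,3)] in \<open>auto simp: u_def norm_minus_commute\<close>)
    moreover have "(\<lambda>n. u n - char (distr M2 borel g) t) \<longlonglongrightarrow> 0"
      by (rule Lim_null_comparison[OF _ lim])
         (use approx[OF assms(2,4)] in \<open>auto simp: u_def norm_minus_commute eq\<close>)
    ultimately show ?thesis
      by (metis LIM_zero_cancel LIMSEQ_unique)
  qed
  then have "distr M1 borel g = distr M2 borel g"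
    using assms(1,2) by (intro Levy_uniqueness prob_space.real_distribution_distr)
      (auto simp: real_distribution_def real_distribution_axioms_def)
  \<comment> \<open>\<open>g\<close> is injective with left inverse -ln v / \<open>c\<close>, which
    carries the equality of laws back to the original measures.\<close>
  then have "distr (distr M1 borel g) borel (\<lambda>v. - ln v / c) = distr (distr M2 borel g) borel (\<lambda>v. - ln v / c)"
    by simp
  moreover have "distr (distr N borel g) borel (\<lambda>v. - ln v / c) = N" if "real_distribution N" for N
  proof -
    interpret real_distribution N by fact
    have "distr (distr N borel g) borel (\<lambda>v. - ln v / c) = distr N borel (\<lambda>x. x)"
      using c by (subst distr_distr) (auto simp: g_def comp_def intro!: distr_cong)
    then show ?thesis by (simp add: distr_id2)
  qed
  ultimately show ?thesis using assms(1,2) by simp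
qed

text \<open>The Gamma integral after the substitution of \<open>l * t\<close> for t. With
  \<open>a\<close> = \<beta> n it gives the transform of one term of the Mittag-Leffler series
  without its sign.\<close>

lemma nn_integral_exp_powr:
  assumes "l > 0" "a \<ge> 0"
  shows "(\<integral>\<^sup>+t. ennreal (indicator {0<..} t * exp (- (l * t)) * (t powr a / Gamma (a + 1))) \<partial>lborel)
    = ennreal (l powr - (a + 1))"
proof -
  have G: "Gamma (a + 1) > 0" using assms by (intro Gamma_real_pos) auto
  then have G': "Gamma (1 + a) > 0" by (simp add: add.commute)
  have "ennreal (Gamma (a + 1)) = (\<integral>\<^sup>+t. ennreal (indicator {0..} t * t powr a / exp t) \<partial>lborel)"
    using Gamma_conv_nn_integral_real[of "a + 1"] assms by simp
  also have "\<dots> = ennreal l * (\<integral>\<^sup>+t. ennreal (indicator {0..} (l * t) * (l * t) powr a / exp (l * t)) \<partial>lborel)"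
    using assms by (subst nn_integral_real_affine[where c = l and t = 0]) auto
  also have "(\<integral>\<^sup>+t. ennreal (indicator {0..} (l * t) * (l * t) powr a / exp (l * t)) \<partial>lborel)
     = (\<integral>\<^sup>+t. ennreal (Gamma (a + 1) * l powr a) *
         ennreal (indicator {0<..} t * exp (- (l * t)) * (t powr a / Gamma (a + 1))) \<partial>lborel)"
  proof (rule nn_integral_cong_AE, rule AE_mp[OF AE_lborel_singleton[of 0]], rule AE_I2, rule impI)
    fix t :: real assume "t \<noteq> 0"
    then consider "t < 0" | "t > 0" by linarith
    then show "ennreal (indicator {0..} (l * t) * (l * t) powr a / exp (l * t)) = ennreal (Gamma (a + 1) * l powr a) *
         ennreal (indicator {0<..} t * exp (- (l * t)) * (t powr a / Gamma (a + 1)))"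
    proof cases
      case 1
      then have "\<not> 0 \<le> l * t" using mult_pos_neg[OF assms(1)] by (simp add: not_le)
      then show ?thesis using 1 by simp
    next
      case 2
      have "indicator {0..} (l * t) * (l * t) powr a / exp (l * t)
          = (Gamma (a + 1) * l powr a) * (indicator {0<..} t * exp (- (l * t)) * (t powr a / Gamma (a + 1)))"
        using assms 2 G'[THEN less_imp_neq, symmetric] by (simp add: powr_mult exp_minus field_simps)
      then show ?thesis using G by (simp only: ennreal_mult'[symmetric] mult_nonneg_nonneg less_imp_le powr_ge_zero)
    qed
  qed
  also have "\<dots> = ennreal (Gamma (a + 1) * l powr a) *
      (\<integral>\<^sup>+t. ennreal (indicator {0<..} t * exp (- (l * t)) * (t powr a / Gamma (a + 1))) \<partial>lborel)" (is "_ = _ * ?I")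
    by (rule nn_integral_cmult) measurable
  finally have *: "ennreal (Gamma (a + 1)) = ennreal l * (ennreal (Gamma (a + 1) * l powr a) * ?I)" .
  define c where "c = l * (Gamma (a + 1) * l powr a)"
  have c: "c > 0" using assms G by (simp add: c_def)
  have **: "ennreal (Gamma (a + 1)) = ennreal c * ?I"
    unfolding * c_def ennreal_mult'[OF less_imp_le[OF assms(1)]] by (simp only: mult.assoc)
  have "?I = ennreal (1 / c) * (ennreal c * ?I)"
    unfolding mult.assoc[symmetric] using c by (subst ennreal_mult'[symmetric]) auto
  also have "\<dots> = ennreal (1 / c * Gamma (a + 1))"
    unfolding **[symmetric] using c by (subst ennreal_mult'[symmetric]) auto
  also have "1 / c * Gamma (a + 1) = l powr - (a + 1)"
    unfolding powr_minus using assms(1) G by (simp add: c_def powr_add field_simps)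
  finally show ?thesis .
qed

text \<open>The absolute values of the terms integrate to q^n / l with q = l^(-\<beta>), and
  \<open>l > 1\<close> makes q < 1. This justifies termwise integration, and the signs turn the sum
  into the geometric series of ratio -q.\<close>

lemma laplace_integral_mittag_leffler:
  assumes \<beta>: "0 < \<beta>" and l: "l > 1"
  shows "has_bochner_integral lborel
    (\<lambda>t. indicator {0<..} t * exp (- (l * t)) * mittag_leffler \<beta> (- (t powr \<beta>)))
    (l powr (\<beta> - 1) / (1 + l powr \<beta>))"
proof -
  define h where "h n t = indicator {0<..} t * exp (- (l * t)) * (t powr (\<beta> * real n) / Gamma (\<beta> * real n + 1))" for n t
  define f where "f n t = (- 1) ^ n * h n t" for n t
  have h0: "h n t \<ge> 0" for n t
    using \<beta> by (auto simp: h_def intro!: mult_nonneg_nonneg divide_nonneg_pos Gamma_real_pos add_nonneg_pos)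
  have hm[measurable]: "h n \<in> borel_measurable borel" for n
    unfolding h_def by measurable
  have nn: "(\<integral>\<^sup>+t. ennreal (h n t) \<partial>lborel) = ennreal (l powr - (\<beta> * real n + 1))" for n
    unfolding h_def using \<beta> l by (intro nn_integral_exp_powr) auto
  have h: "has_bochner_integral lborel (h n) (l powr - (\<beta> * real n + 1))" for n
    using h0 nn by (intro has_bochner_integral_nn_integral) auto
  define q where "q = l powr - \<beta>"
  have q: "0 < q" "q < 1"
    using l \<beta> by (auto simp: q_def powr_less_one)
  have lq: "l powr - (\<beta> * real n + 1) = q ^ n / l" for n
  proof -
    have "l powr - (\<beta> * real n + 1) = l powr (- \<beta> * real n) * l powr (-1)"
      by (subst powr_add[symmetric]) simp
    also have "l powr (- \<beta> * real n) = q ^ n"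
      using l unfolding q_def by (subst powr_realpow[symmetric]) (auto simp: powr_powr)
    finally show ?thesis using l by (simp add: powr_minus_divide)
  qed
  have norm_f: "norm (f n t) = h n t" for n t
    using h0 by (simp add: f_def abs_mult power_abs)
  have fi: "has_bochner_integral lborel (f n) ((- q) ^ n / l)" for n
    using has_bochner_integral_mult_right[OF h[of n], of "(-1) ^ n"]
    unfolding f_def lq by (simp add: power_minus[of q])
  have sums1: "summable (\<lambda>n. q ^ n / l)"
    using q by (intro summable_divide summable_geometric) auto
  have "(\<integral>\<^sup>+t. (\<Sum>n. ennreal (h n t)) \<partial>lborel) = (\<Sum>n. ennreal (q ^ n / l))"
    using nn lq by (subst nn_integral_suminf) auto
  moreover have "(\<Sum>n. ennreal (q ^ n / l)) \<noteq> top"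
    using q l by (intro ennreal_suminf_neq_top[OF sums1]) auto
  \<comment> \<open>Convergence of the Mittag-Leffler series at almost every t follows from the
    finite integral of the absolute series, in place of growth estimates for Gamma.\<close>
  ultimately have "AE t in lborel. (\<Sum>n. ennreal (h n t)) \<noteq> \<infinity>"
    by (intro nn_integral_PInf_AE) auto
  then have AE: "AE t in lborel. summable (\<lambda>n. norm (f n t))"
    unfolding norm_f by eventually_elim (use h0 in \<open>auto intro!: summable_suminf_not_top\<close>)
  have sums2: "summable (\<lambda>n. \<integral>t. norm (f n t) \<partial>lborel)"
    unfolding norm_f has_bochner_integral_integral_eq[OF h] lq by (rule sums1)
  have intf: "integrable lborel (f n)" for n using fi by (auto simp: has_bochner_integral_iff)
  have "has_bochner_integral lborel (\<lambda>t. \<Sum>n. f n t) (\<Sum>n. (- q) ^ n / l)"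
    unfolding has_bochner_integral_iff
    using integrable_suminf[OF intf AE sums2] integral_suminf[OF intf AE sums2]
    by (simp add: has_bochner_integral_integral_eq[OF fi])
  also have "(\<Sum>n. (- q) ^ n / l) = 1 / (1 + q) / l"
    using q suminf_divide[OF summable_geometric[of "- q"]] by (simp add: suminf_geometric)
  also have "\<dots> = l powr (\<beta> - 1) / (1 + l powr \<beta>)"
    using l by (simp add: q_def powr_diff powr_minus field_simps)
  finally have main: "has_bochner_integral lborel (\<lambda>t. \<Sum>n. f n t) (l powr (\<beta> - 1) / (1 + l powr \<beta>))" .
  have [measurable]: "f n \<in> borel_measurable borel" for n
    unfolding f_def by measurable
  have "AE t in lborel. indicator {0<..} t * exp (- (l * t)) * mittag_leffler \<beta> (- (t powr \<beta>)) = (\<Sum>n. f n t)"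
    using AE
  proof eventually_elim
    fix t assume t: "summable (\<lambda>n. norm (f n t))"
    show "indicator {0<..} t * exp (- (l * t)) * mittag_leffler \<beta> (- (t powr \<beta>)) = (\<Sum>n. f n t)"
    proof (cases "t > 0")
      case True
      have pw: "(t powr \<beta>) ^ n = t powr (\<beta> * real n)" for n
        using True by (simp add: powr_powr[symmetric] powr_realpow)
      have f: "f n t = exp (- (l * t)) * ((- (t powr \<beta>)) ^ n / Gamma (\<beta> * real n + 1))" for n
        using True by (simp add: f_def h_def power_minus[of "t powr \<beta>"] pw)
      have "summable (\<lambda>n. (- (t powr \<beta>)) ^ n / Gamma (\<beta> * real n + 1))"
        by (rule summable_mult_D[OF summable_norm_cancel[OF t[unfolded f]]]) simp
      from suminf_mult[OF this, of "exp (- (l * t))"] show ?thesis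
        using \<open>t > 0\<close> unfolding f mittag_leffler_def by simp
    qed (simp add: f_def h_def)
  qed
  then show ?thesis
    using main by (subst has_bochner_integral_cong_AE) (auto simp: mittag_leffler_def)
qed

text \<open>Writing 1 - exp (-l T) as the integral of l exp (-l t) over 0 < t < T and exchanging
  integrals brings in the survival function directly, without a density. Order 1 covers the
  exponential law.\<close>

lemma (in prob_space) laplace_mittag_leffler:
  assumes [measurable]: "random_variable borel T" and pos: "AE \<omega> in M. 0 < T \<omega>"
    and surv: "\<And>t. 0 \<le> t \<Longrightarrow> prob {\<omega>\<in>space M. T \<omega> > t} = mittag_leffler \<beta> (- (t powr \<beta>))"
    and \<beta>: "0 < \<beta>" and l: "l > 1"
  shows "expectation (\<lambda>\<omega>. exp (- (l * T \<omega>))) = 1 / (1 + l powr \<beta>)"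
proof -
  let ?k = "\<lambda>t. indicator {0<..} t * exp (- (l * t)) :: real"
  interpret L: pair_sigma_finite M lborel ..
  have eq: "ennreal (1 - exp (- (l * T \<omega>))) = (\<integral>\<^sup>+t. ennreal (l * ?k t) * indicator {..<T \<omega>} t \<partial>lborel)"
    if "0 < T \<omega>" for \<omega>
  proof -
    have "(\<integral>\<^sup>+t. ennreal (l * exp (- (l * t))) * indicator {0..T \<omega>} t \<partial>lborel)
      = ennreal ((- exp (- (l * T \<omega>))) - (- exp (- (l * 0))))"
      using l that by (intro nn_integral_FTC_Icc) (auto intro!: derivative_eq_intros)
    also have "(\<integral>\<^sup>+t. ennreal (l * exp (- (l * t))) * indicator {0..T \<omega>} t \<partial>lborel)
      = (\<integral>\<^sup>+t. ennreal (l * ?k t) * indicator {..<T \<omega>} t \<partial>lborel)"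
    proof (intro nn_integral_cong_AE)
      show "AE t in lborel. ennreal (l * exp (- (l * t))) * indicator {0..T \<omega>} t = ennreal (l * ?k t) * indicator {..<T \<omega>} t"
        using AE_lborel_singleton[of 0] AE_lborel_singleton[of "T \<omega>"]
        by eventually_elim (auto simp: indicator_def)
    qed
    finally show ?thesis by simp
  qed
  have bd: "AE \<omega> in M. norm (exp (- (l * T \<omega>))) \<le> 1"
    using pos by eventually_elim (use l in auto)
  have int: "integrable M (\<lambda>\<omega>. exp (- (l * T \<omega>)))"
    by (rule integrable_const_bound[OF bd]) simp
  have "(\<integral>\<^sup>+\<omega>. ennreal (1 - exp (- (l * T \<omega>))) \<partial>M)
      = (\<integral>\<^sup>+\<omega>. \<integral>\<^sup>+t. ennreal (l * ?k t) * indicator {..<T \<omega>} t \<partial>lborel \<partial>M)"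
    using pos by (intro nn_integral_cong_AE) (auto simp: eq)
  also have "\<dots> = (\<integral>\<^sup>+t. \<integral>\<^sup>+\<omega>. ennreal (l * ?k t) * indicator {..<T \<omega>} t \<partial>M \<partial>lborel)"
  proof (rule L.Fubini'[symmetric])
    show "(\<lambda>(\<omega>, t). ennreal (l * ?k t) * indicator {..<T \<omega>} t) \<in> borel_measurable (M \<Otimes>\<^sub>M lborel)"
      unfolding indicator_def lessThan_iff greaterThan_iff by measurable
  qed
  also have "\<dots> = (\<integral>\<^sup>+t. ennreal (l * (?k t * mittag_leffler \<beta> (- (t powr \<beta>)))) \<partial>lborel)"
  proof (intro nn_integral_cong)
    fix t :: real
    show "(\<integral>\<^sup>+\<omega>. ennreal (l * ?k t) * indicator {..<T \<omega>} t \<partial>M) = ennreal (l * (?k t * mittag_leffler \<beta> (- (t powr \<beta>))))"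
    proof (cases "t > 0")
      case True
      have "(\<integral>\<^sup>+\<omega>. ennreal (l * ?k t) * indicator {..<T \<omega>} t \<partial>M)
          = (\<integral>\<^sup>+\<omega>. ennreal (l * ?k t) * indicator {\<omega>\<in>space M. T \<omega> > t} \<omega> \<partial>M)"
        by (intro nn_integral_cong) (auto simp: indicator_def)
      also have "\<dots> = ennreal (l * ?k t) * emeasure M {\<omega>\<in>space M. T \<omega> > t}"
        by (subst nn_integral_cmult_indicator) auto
      also have "emeasure M {\<omega>\<in>space M. T \<omega> > t} = ennreal (mittag_leffler \<beta> (- (t powr \<beta>)))"
        using surv[of t] True by (simp add: emeasure_eq_measure)
      also have "ennreal (l * ?k t) * \<dots> = ennreal (l * ?k t * mittag_leffler \<beta> (- (t powr \<beta>)))"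
        using l by (subst ennreal_mult') (auto simp: indicator_def)
      finally show ?thesis by (simp add: mult_ac)
    qed simp
  qed
  also have "\<dots> = ennreal (l * (l powr (\<beta> - 1) / (1 + l powr \<beta>)))"
  proof -
    have "has_bochner_integral lborel (\<lambda>t. l * (?k t * mittag_leffler \<beta> (- (t powr \<beta>))))
      (l * (l powr (\<beta> - 1) / (1 + l powr \<beta>)))"
      by (rule has_bochner_integral_mult_right) (use laplace_integral_mittag_leffler[OF \<beta> l] in auto)
    \<comment> \<open>The Mittag-Leffler function is nonnegative here because its value is a
      probability.\<close>
    moreover have "l * (?k t * mittag_leffler \<beta> (- (t powr \<beta>))) \<ge> 0" for t
      using l surv[of t, symmetric] by (auto simp: indicator_def)
    ultimately show ?thesis
      by (auto simp: has_bochner_integral_iff nn_integral_eq_integral)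
  qed
  also have "l * (l powr (\<beta> - 1) / (1 + l powr \<beta>)) = 1 - 1 / (1 + l powr \<beta>)"
    using l by (simp add: powr_diff field_simps add_pos_pos[THEN less_imp_neq, symmetric])
  finally have "(\<integral>\<^sup>+\<omega>. ennreal (1 - exp (- (l * T \<omega>))) \<partial>M) = ennreal (1 - 1 / (1 + l powr \<beta>))" .
  moreover have "AE \<omega> in M. 0 \<le> 1 - exp (- (l * T \<omega>))"
    using bd by eventually_elim auto
  ultimately have "expectation (\<lambda>\<omega>. 1 - exp (- (l * T \<omega>))) = 1 - 1 / (1 + l powr \<beta>)"
    by (subst (asm) nn_integral_eq_integrable) (use l in \<open>auto simp: field_simps add_pos_nonneg\<close>)
  then show ?thesis using int by (simp add: prob_space)
qed

section \<open>First passage times and paths\<close>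

text \<open>Restricting the infimum to rational times makes it a measurable function of the whole path,
  whatever the path. As in \<open>inverse_process\<close>, the value is 0 when the level is never exceeded.\<close>

definition rational_hitting_time :: "(real \<Rightarrow> real) \<Rightarrow> real \<Rightarrow> real" where
  "rational_hitting_time p c =
     (if {q\<in>\<rat>. 0 \<le> q \<and> c < p q} = {} then 0 else Inf {q\<in>\<rat>. 0 \<le> q \<and> c < p q})"

lemma rational_hitting_time_nonneg: "0 \<le> rational_hitting_time p c"
  unfolding rational_hitting_time_def by (auto intro!: cInf_greatest)

lemma rational_hitting_time_cong:
  "(\<And>q. 0 \<le> q \<Longrightarrow> p q = p' q) \<Longrightarrow> rational_hitting_time p c = rational_hitting_time p' c"
proof -
  assume *: "\<And>q. 0 \<le> q \<Longrightarrow> p q = p' q"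
  have "{q\<in>\<rat>. 0 \<le> q \<and> c < p q} = {q\<in>\<rat>. 0 \<le> q \<and> c < p' q}"
    using * by auto
  then show ?thesis by (simp only: rational_hitting_time_def)
qed

text \<open>Rewrites a bound on the infimum with quantifiers over the rationals only, which
  preserves measurability. The second disjunct is the default value 0.\<close>

lemma rational_hitting_time_less_iff:
  "rational_hitting_time p c < a \<longleftrightarrow>
     (\<exists>q\<in>\<rat>. 0 \<le> q \<and> q < a \<and> c < p q) \<or> ((\<forall>q\<in>\<rat>. 0 \<le> q \<longrightarrow> \<not> c < p q) \<and> 0 < a)"
proof (cases "{q\<in>\<rat>. 0 \<le> q \<and> c < p q} = {}")
  case False
  have "Inf {q\<in>\<rat>. 0 \<le> q \<and> c < p q} < a \<longleftrightarrow> (\<exists>q\<in>{q\<in>\<rat>. 0 \<le> q \<and> c < p q}. q < a)"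
    by (rule cInf_less_iff[OF False]) (auto intro!: bdd_belowI[of _ 0])
  then show ?thesis using False by (auto simp: rational_hitting_time_def)
qed (auto simp: rational_hitting_time_def)

lemma measurable_rational_hitting_time:
  assumes "\<And>q. 0 \<le> q \<Longrightarrow> X q \<in> borel_measurable N"
  shows "(\<lambda>\<omega>. rational_hitting_time (\<lambda>q. X q \<omega>) c) \<in> borel_measurable N"
proof (rule borel_measurableI_less)
  fix a :: real
  \<comment> \<open>The extension by 0 is measurable for every q, so the countable quantifiers can
    run over all rationals.\<close>
  define Y where "Y q \<omega> = (if 0 \<le> q then X q \<omega> else 0)" for q \<omega>
  have [measurable]: "Y q \<in> borel_measurable N" for q
    using assms[of q] unfolding Y_def by (cases "0 \<le> q") simp_all
  have "rational_hitting_time (\<lambda>q. X q \<omega>) c = rational_hitting_time (\<lambda>q. Y q \<omega>) c" for \<omega>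
    by (rule rational_hitting_time_cong) (simp add: Y_def)
  then have "{\<omega> \<in> space N. rational_hitting_time (\<lambda>q. X q \<omega>) c < a} =
      {\<omega> \<in> space N. (\<exists>r::rat. 0 \<le> real_of_rat r \<and> real_of_rat r < a \<and> c < Y (real_of_rat r) \<omega>)
      \<or> ((\<forall>r::rat. 0 \<le> real_of_rat r \<longrightarrow> \<not> c < Y (real_of_rat r) \<omega>) \<and> 0 < a)}"
    by (simp only: rational_hitting_time_less_iff Rats_def bex_simps ball_simps) simp
  also have "\<dots> \<in> sets N" by measurable
  finally show "{\<omega> \<in> space N. rational_hitting_time (\<lambda>q. X q \<omega>) c < a} \<in> sets N" .
qed

text \<open>By monotonicity a level exceeded at \<tau> stays exceeded at rational times just after
  \<tau>, so restricting to rationals does not raise the infimum.\<close>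

lemma inverse_process_eq_rational_hitting_time:
  assumes mono: "mono_on {0..} (\<lambda>\<tau>. D \<tau> \<omega>)"
  shows "inverse_process D t \<omega> = rational_hitting_time (\<lambda>\<tau>. D \<tau> \<omega>) t"
proof -
  let ?A = "{\<tau>. 0 \<le> \<tau> \<and> D \<tau> \<omega> > t}" and ?B = "{q\<in>\<rat>. 0 \<le> q \<and> t < D q \<omega>}"
  have dense: "\<exists>q\<in>?B. q < b" if "\<tau> \<in> ?A" "\<tau> < b" for \<tau> b
  proof -
    from Rats_dense_in_real[OF \<open>\<tau> < b\<close>] obtain q where "q \<in> \<rat>" "\<tau> < q" "q < b" by auto
    then show ?thesis using that mono_onD[OF mono, of \<tau> q] by force
  qed
  have sub: "?B \<subseteq> ?A" by auto
  show ?thesis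
  proof (cases "?A = {}")
    case True
    then have "?B = {}" by blast
    with True show ?thesis unfolding inverse_process_def rational_hitting_time_def by simp
  next
    case False
    then obtain \<tau> where "\<tau> \<in> ?A" by blast
    from dense[OF this, of "\<tau> + 1"] have B: "?B \<noteq> {}" by force
    have bdd: "bdd_below ?A" "bdd_below ?B" by (auto intro!: bdd_belowI[of _ 0])
    have "Inf ?A = Inf ?B"
    proof (rule antisym)
      show "Inf ?A \<le> Inf ?B" by (rule cInf_superset_mono[OF B bdd(1) sub])
      show "Inf ?B \<le> Inf ?A"
      proof (rule cInf_greatest[OF False])
        fix \<tau> assume "\<tau> \<in> ?A"
        show "Inf ?B \<le> \<tau>"
        proof (rule dense_ge)
          fix b assume "\<tau> < b"
          from dense[OF \<open>\<tau> \<in> ?A\<close> this] show "Inf ?B \<le> b"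
            using cInf_lower[OF _ bdd(2)] by force
        qed
      qed
    qed
    then show ?thesis unfolding inverse_process_def rational_hitting_time_def if_not_P[OF B] if_not_P[OF False] .
  qed
qed

lemma rational_hitting_time_jump:
  fixes y :: "real \<Rightarrow> nat"
  assumes "0 \<le> s" and iff: "\<And>t. 0 \<le> t \<Longrightarrow> n \<le> y t \<longleftrightarrow> s \<le> t"
  shows "rational_hitting_time (\<lambda>q. real (y q)) (real n - 1) = s"
proof -
  have "(real n - 1 < real (y q)) = (n \<le> y q)" for q by linarith
  then have eq: "{q\<in>\<rat>. 0 \<le> q \<and> real n - 1 < real (y q)} = {q\<in>\<rat>. s \<le> q}" (is "_ = ?B")
    using assms by auto
  have dense: "\<exists>q\<in>?B. q < b" if "s < b" for b
    using Rats_dense_in_real[OF that] by force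
  have B: "?B \<noteq> {}" using dense[of "s + 1"] by auto
  have "Inf ?B = s"
  proof (rule antisym)
    show "Inf ?B \<le> s"
    proof (rule dense_ge)
      fix b assume "s < b"
      from dense[OF this] show "Inf ?B \<le> b"
        using cInf_lower[of _ ?B] by (force intro!: bdd_belowI[of _ s])
    qed
    show "s \<le> Inf ?B" using B by (intro cInf_greatest) auto
  qed
  then show ?thesis unfolding rational_hitting_time_def eq if_not_P[OF B] .
qed

text \<open>Positive waiting times make the partial sums nondecreasing, and unboundedness makes the
  set under \<open>Max\<close> finite; so \<open>Max\<close> is attained and the set is an initial
  segment.\<close>

lemma le_renewal_count_iff:
  assumes pos: "\<And>j. 1 \<le> j \<Longrightarrow> 0 < T j \<omega>" and unbdd: "\<And>K. \<exists>n. K < (\<Sum>j=1..n. T j \<omega>)"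
    and t: "0 \<le> t"
  shows "n \<le> renewal_count T t \<omega> \<longleftrightarrow> (\<Sum>j=1..n. T j \<omega>) \<le> t"
proof -
  let ?S = "\<lambda>n. \<Sum>j=1..n. T j \<omega>" and ?A = "{n. (\<Sum>j=1..n. T j \<omega>) \<le> t}"
  have mono: "?S m \<le> ?S n" if "m \<le> n" for m n
    using that pos by (intro sum_mono2) (auto intro: less_imp_le)
  obtain N where N: "t < ?S N" using unbdd by blast
  have "n \<le> N" if "n \<in> ?A" for n
    using N mono[of N n] that by (cases "n \<le> N") auto
  then have fin: "finite ?A" by (auto intro: finite_subset[of _ "{..N}"])
  have ne: "0 \<in> ?A" using t by simp
  show ?thesis
  proof
    assume "n \<le> renewal_count T t \<omega>"
    then have "?S n \<le> ?S (Max ?A)" unfolding renewal_count_def by (rule mono)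
    also have "\<dots> \<le> t" using Max_in[OF fin] ne by blast
    finally show "?S n \<le> t" .
  next
    assume "?S n \<le> t"
    then show "n \<le> renewal_count T t \<omega>"
      unfolding renewal_count_def by (intro Max_ge fin) simp
  qed
qed

text \<open>Monotonicity alone gives the direction from \<open>D s \<omega> \<le> t\<close>. For the
  other one, if D exceeded t at s, \<open>left\<close> would give an earlier time at which it
  already does, pushing the infimum below s. At s = 0 the bound on \<open>D 0 \<omega>\<close> takes
  over.\<close>

lemma le_inverse_process_iff:
  assumes mono: "mono_on {0..} (\<lambda>\<tau>. D \<tau> \<omega>)" and "D 0 \<omega> \<le> t"
    and unbdd: "\<exists>\<tau>\<ge>0. t < D \<tau> \<omega>" and "0 \<le> s"
    and left: "\<And>e. 0 < s \<Longrightarrow> 0 < e \<Longrightarrow> \<exists>\<tau>\<ge>0. \<tau> < s \<and> D s \<omega> - e < D \<tau> \<omega>"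
  shows "s \<le> inverse_process D t \<omega> \<longleftrightarrow> D s \<omega> \<le> t"
proof -
  let ?A = "{\<tau>. 0 \<le> \<tau> \<and> D \<tau> \<omega> > t}"
  have A: "?A \<noteq> {}" using unbdd by auto
  have L: "inverse_process D t \<omega> = Inf ?A" unfolding inverse_process_def by (rule if_not_P[OF A])
  show ?thesis
  proof
    assume *: "D s \<omega> \<le> t"
    have "s \<le> \<tau>" if "\<tau> \<in> ?A" for \<tau>
      using that * mono_onD[OF mono, of \<tau> s] \<open>0 \<le> s\<close> by (cases "s \<le> \<tau>") auto
    then show "s \<le> inverse_process D t \<omega>" unfolding L by (intro cInf_greatest A)
  next
    assume *: "s \<le> inverse_process D t \<omega>"
    show "D s \<omega> \<le> t"
    proof (rule ccontr)
      assume "\<not> D s \<omega> \<le> t"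
      then have "0 < s" "0 < D s \<omega> - t" using assms(2) \<open>0 \<le> s\<close> by (cases "s = 0"; auto)+
      from left[OF this] obtain \<tau> where "\<tau> \<in> ?A" "\<tau> < s" by auto
      then have "Inf ?A \<le> \<tau>" by (intro cInf_lower) (auto intro!: bdd_belowI[of _ 0])
      then show False using * \<open>\<tau> < s\<close> unfolding L by simp
    qed
  qed
qed

text \<open>The evaluation map \<open>(s, d) \<mapsto> d s\<close> is not measurable on the product \<open>\<sigma>\<close>-algebra. This limit
  along a grid is, and it agrees with \<open>d s\<close> when \<open>d\<close> is right-continuous.\<close>

definition grid_eval :: "real \<Rightarrow> (real \<Rightarrow> real) \<Rightarrow> real" where
  "grid_eval s d = lim (\<lambda>k. d ((real (nat \<lfloor>real (Suc k) * s\<rfloor>) + 1) / real (Suc k)))"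

text \<open>For each k only countably many grid times occur, and at each of them a single coordinate
  of the path is read.\<close>

lemma measurable_grid_eval [measurable]:
  "(\<lambda>(s, d). grid_eval s d) \<in> borel_measurable (borel \<Otimes>\<^sub>M path_space borel)"
proof -
  have "(\<lambda>x. snd x ((real (nat \<lfloor>real (Suc k) * fst x\<rfloor>) + 1) / real (Suc k)))
      \<in> borel_measurable (borel \<Otimes>\<^sub>M path_space borel)" for k
  proof (rule measurable_compose_countable[where f = "\<lambda>i x. snd x ((real i + 1) / real (Suc k))"])
    show "(\<lambda>x. snd x ((real i + 1) / real (Suc k))) \<in> borel_measurable (borel \<Otimes>\<^sub>M path_space borel)" for i
      by (rule measurable_compose[OF measurable_snd measurable_component_singleton]) auto
    show "(\<lambda>x. nat \<lfloor>real (Suc k) * fst x\<rfloor>) \<in> measurable (borel \<Otimes>\<^sub>M path_space borel) (count_space UNIV)"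
      by measurable
  qed
  then show ?thesis
    unfolding grid_eval_def case_prod_beta by measurable
qed

text \<open>The \<open>+ 1\<close> in the grid puts every grid time strictly to the right of s, at
  distance at most 1 / (k + 1), so right-continuity gives the limit.\<close>

lemma grid_eval_path_of:
  assumes "cadlag_path (\<lambda>\<tau>. D \<tau> \<omega>)" and s: "0 \<le> s"
  shows "grid_eval s (path_of D \<omega>) = D s \<omega>"
proof -
  define r where "r k = (real (nat \<lfloor>real (Suc k) * s\<rfloor>) + 1) / real (Suc k)" for k
  have r: "s < r k" "r k \<le> s + 1 / real (Suc k)" for k
  proof -
    define K where "K = real (Suc k)"
    have K: "K > 0" by (simp add: K_def)
    have rk: "r k = (of_int \<lfloor>K * s\<rfloor> + 1) / K"
      unfolding r_def K_def[symmetric] using s K by simp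
    show "s < r k"
      unfolding rk pos_less_divide_eq[OF K] using floor_correct[of "K * s"] by (simp add: mult.commute)
    have "(of_int \<lfloor>K * s\<rfloor> + 1) / K \<le> (K * s + 1) / K"
      using K by (intro divide_right_mono add_mono) auto
    then show "r k \<le> s + 1 / real (Suc k)"
      unfolding rk K_def[symmetric] using K by (simp add: add_divide_distrib)
  qed
  have "r \<longlonglongrightarrow> s"
  proof (rule tendsto_sandwich[of "\<lambda>_. s"])
    show "\<forall>\<^sub>F k in sequentially. s \<le> r k" "\<forall>\<^sub>F k in sequentially. r k \<le> s + 1 / real (Suc k)"
      using r by (auto intro!: always_eventually less_imp_le simp del: of_nat_Suc)
    show "(\<lambda>k. s + 1 / real (Suc k)) \<longlonglongrightarrow> s"
      using tendsto_add[OF tendsto_const[of s] LIMSEQ_inverse_real_of_nat] by (simp add: inverse_eq_divide)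
  qed simp
  then have "filterlim r (at_right s) sequentially"
    using r by (auto simp: filterlim_at intro!: always_eventually)
  moreover have "((\<lambda>\<tau>. D \<tau> \<omega>) \<longlongrightarrow> D s \<omega>) (at_right s)"
    using assms unfolding cadlag_path_def by blast
  ultimately have "(\<lambda>k. D (r k) \<omega>) \<longlonglongrightarrow> D s \<omega>"
    by (rule filterlim_compose[rotated])
  moreover have "path_of D \<omega> (r k) = D (r k) \<omega>" for k
    using r(1)[of k] s by (simp add: path_of_def)
  ultimately show ?thesis
    unfolding grid_eval_def r_def[symmetric] by (simp add: limI)
qed

text \<open>The substitute for conditioning on X: the inner integral sees the path of X as a
  constant while Y runs over an independent copy of the probability space.\<close>

lemma (in prob_space) nn_integral_independent_processes:
  assumes ind: "independent_processes S X S' Y"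
    and F: "F \<in> borel_measurable (path_space S \<Otimes>\<^sub>M path_space S')"
  shows "(\<integral>\<^sup>+\<omega>. F (path_of X \<omega>, path_of Y \<omega>) \<partial>M)
    = (\<integral>\<^sup>+\<omega>. \<integral>\<^sup>+\<omega>'. F (path_of X \<omega>, path_of Y \<omega>') \<partial>M \<partial>M)"
proof -
  let ?X = "distr M (path_space S) (path_of X)" and ?Y = "distr M (path_space S') (path_of Y)"
  have path[measurable]: "path_of X \<in> measurable M (path_space S)" "path_of Y \<in> measurable M (path_space S')"
    using ind by (auto simp: independent_processes_def)
  interpret X: prob_space ?X by (rule prob_space_distr) measurable
  interpret Y: prob_space ?Y by (rule prob_space_distr) measurable
  have [measurable]: "F \<in> borel_measurable (?X \<Otimes>\<^sub>M ?Y)"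
    using F by (simp cong: measurable_cong_sets sets_pair_measure_cong)
  have prod: "?X \<Otimes>\<^sub>M ?Y = distr M (path_space S \<Otimes>\<^sub>M path_space S') (\<lambda>\<omega>. (path_of X \<omega>, path_of Y \<omega>))"
  proof (rule pair_measure_eqI)
    fix A B assume A: "A \<in> sets ?X" and B: "B \<in> sets ?Y"
    have "prob ((path_of X -` A \<inter> space M) \<inter> (path_of Y -` B \<inter> space M))
      = prob (path_of X -` A \<inter> space M) * prob (path_of Y -` B \<inter> space M)"
      using ind A B unfolding independent_processes_def by (intro indep_setD) auto
    moreover have "(\<lambda>\<omega>. (path_of X \<omega>, path_of Y \<omega>)) -` (A \<times> B) \<inter> space M
        = (path_of X -` A \<inter> space M) \<inter> (path_of Y -` B \<inter> space M)" by auto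
    ultimately show "emeasure ?X A * emeasure ?Y B
      = emeasure (distr M (path_space S \<Otimes>\<^sub>M path_space S') (\<lambda>\<omega>. (path_of X \<omega>, path_of Y \<omega>))) (A \<times> B)"
      using A B by (simp add: emeasure_distr emeasure_eq_measure ennreal_mult)
  qed (simp_all add: X.sigma_finite_measure_axioms Y.sigma_finite_measure_axioms cong: sets_pair_measure_cong)
  have "(\<integral>\<^sup>+\<omega>. F (path_of X \<omega>, path_of Y \<omega>) \<partial>M) = (\<integral>\<^sup>+z. F z \<partial>(?X \<Otimes>\<^sub>M ?Y))"
    unfolding prod using F by (subst nn_integral_distr) auto
  also have "\<dots> = (\<integral>\<^sup>+a. \<integral>\<^sup>+b. F (a, b) \<partial>?Y \<partial>?X)"
    by (rule Y.nn_integral_fst[symmetric]) measurable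
  also have "\<dots> = (\<integral>\<^sup>+\<omega>. \<integral>\<^sup>+b. F (path_of X \<omega>, b) \<partial>?Y \<partial>M)"
  proof -
    have "F \<in> borel_measurable (path_space S \<Otimes>\<^sub>M ?Y)"
      using F by (simp cong: measurable_cong_sets sets_pair_measure_cong)
    from Y.borel_measurable_nn_integral_fst[OF this]
    show ?thesis by (subst nn_integral_distr) auto
  qed
  also have "\<dots> = (\<integral>\<^sup>+\<omega>. \<integral>\<^sup>+\<omega>'. F (path_of X \<omega>, path_of Y \<omega>') \<partial>M \<partial>M)"
  proof (intro nn_integral_cong)
    fix \<omega> assume "\<omega> \<in> space M"
    then have "path_of X \<omega> \<in> space (path_space S)"
      by (rule measurable_space[OF path(1)])
    then show "(\<integral>\<^sup>+b. F (path_of X \<omega>, b) \<partial>?Y) = (\<integral>\<^sup>+\<omega>'. F (path_of X \<omega>, path_of Y \<omega>') \<partial>M)"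
      using F by (subst nn_integral_distr) auto
  qed
  finally show ?thesis .
qed

text \<open>A Markov bound: on the event that all \<open>X n\<close> stay below K, every exp (-c X
  n) is at least exp (-c K), so the vanishing transforms force that event to be null.\<close>

lemma (in prob_space) AE_unbounded_of_laplace:
  fixes X :: "nat \<Rightarrow> 'a \<Rightarrow> real"
  assumes [measurable]: "\<And>n. random_variable borel (X n)" and c: "c > 0"
    and lim: "(\<lambda>n. \<integral>\<^sup>+\<omega>. ennreal (exp (- (c * X n \<omega>))) \<partial>M) \<longlonglongrightarrow> 0"
  shows "AE \<omega> in M. \<forall>K. \<exists>n. K < X n \<omega>"
proof -
  have "AE \<omega> in M. \<exists>n. real K < X n \<omega>" for K :: nat
  proof -
    let ?A = "{\<omega>\<in>space M. \<forall>n. X n \<omega> \<le> real K}"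
    have A[measurable]: "?A \<in> sets M" by measurable
    have "ennreal (exp (- (c * real K))) * emeasure M ?A \<le> (\<integral>\<^sup>+\<omega>. ennreal (exp (- (c * X n \<omega>))) \<partial>M)" for n
    proof -
      have "ennreal (exp (- (c * real K))) * emeasure M ?A = (\<integral>\<^sup>+\<omega>. ennreal (exp (- (c * real K))) * indicator ?A \<omega> \<partial>M)"
        using A by (simp add: nn_integral_cmult_indicator)
      also have "\<dots> \<le> (\<integral>\<^sup>+\<omega>. ennreal (exp (- (c * X n \<omega>))) \<partial>M)"
        using c by (intro nn_integral_mono) (auto simp: indicator_def intro!: ennreal_leI)
      finally show ?thesis .
    qed
    then have "ennreal (exp (- (c * real K))) * emeasure M ?A \<le> 0"
      by (intro LIMSEQ_le_const[OF lim]) auto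
    then have "emeasure M ?A = 0" by simp
    then show ?thesis
      by (intro AE_I[of _ _ ?A]) (auto simp: not_less)
  qed
  then have "AE \<omega> in M. \<forall>K::nat. \<exists>n. real K < X n \<omega>"
    by (simp add: AE_all_countable)
  then show ?thesis
  proof eventually_elim
    case (elim \<omega>)
    show ?case
    proof
      fix K :: real
      obtain k :: nat where "K < real k" using reals_Archimedean2 by blast
      with elim show "\<exists>n. K < X n \<omega>" using order.strict_trans by blast
    qed
  qed
qed

section \<open>Renewal processes subordinated to a stable process\<close>

lemma measurable_renewal_count:
  assumes [measurable]: "\<And>j. 1 \<le> j \<Longrightarrow> T j \<in> borel_measurable N" "f \<in> borel_measurable N"
  shows "(\<lambda>\<omega>. renewal_count T (f \<omega>) \<omega>) \<in> measurable N (count_space UNIV)"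
proof -
  have [measurable]: "(\<lambda>\<omega>. \<Sum>j=1..n. T j \<omega>) \<in> borel_measurable N" for n
    by (intro borel_measurable_sum) auto
  show ?thesis unfolding renewal_count_def by measurable
qed

text \<open>Both path laws are images of a product of waiting time laws under the same measurable
  map \<open>\<Phi>\<close>, so equal marginals suffice. Agreement with the renewal count is
  required only almost surely, but for all t simultaneously.\<close>

lemma equal_in_law_of_renewal:
  fixes M :: "'a measure" and M' :: "'b measure"
  assumes M: "prob_space M" "prob_space.indep_vars M (\<lambda>_. borel) T {1..}"
      "\<And>t. 0 \<le> t \<Longrightarrow> X t \<in> measurable M (count_space UNIV)"
      "AE \<omega> in M. \<forall>t\<ge>0. X t \<omega> = renewal_count T t \<omega>"
    and M': "prob_space M'" "prob_space.indep_vars M' (\<lambda>_. borel) T' {1..}"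
      "\<And>t. 0 \<le> t \<Longrightarrow> X' t \<in> measurable M' (count_space UNIV)"
      "AE \<omega> in M'. \<forall>t\<ge>0. X' t \<omega> = renewal_count T' t \<omega>"
    and law: "\<And>j. 1 \<le> j \<Longrightarrow> distr M borel (T j) = distr M' borel (T' j)"
  shows "equal_in_law (count_space UNIV) M X M' X'"
proof -
  define \<Phi> :: "(nat \<Rightarrow> real) \<Rightarrow> real \<Rightarrow> nat" where
    "\<Phi> u = (\<lambda>t\<in>{0..}. renewal_count (\<lambda>j u. u j) t u)" for u
  have \<Phi>[measurable]: "\<Phi> \<in> measurable (\<Pi>\<^sub>M j\<in>{1..}. borel) (path_space (count_space UNIV))"
    unfolding \<Phi>_def by (intro measurable_restrict measurable_renewal_count) auto
  have *: "distr N (path_space (count_space UNIV)) (path_of Y)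
      = distr (\<Pi>\<^sub>M j\<in>{1..}. distr N borel (S j)) (path_space (count_space UNIV)) \<Phi>"
    if N: "prob_space N" and ind: "prob_space.indep_vars N (\<lambda>_. borel) S {1..}"
      and Y: "\<And>t. 0 \<le> t \<Longrightarrow> Y t \<in> measurable N (count_space UNIV)"
      and AE: "AE \<omega> in N. \<forall>t\<ge>0. Y t \<omega> = renewal_count S t \<omega>"
    for N :: "'c measure" and S Y
  proof -
    interpret prob_space N by fact
    have S[measurable]: "1 \<le> j \<Longrightarrow> random_variable borel (S j)" for j
      using ind by (auto simp: indep_vars_def)
    have path: "path_of Y \<in> measurable N (path_space (count_space UNIV))"
      unfolding path_of_def by (intro measurable_restrict Y) auto
    have seq: "(\<lambda>\<omega>. \<lambda>j\<in>{1..}. S j \<omega>) \<in> measurable N (\<Pi>\<^sub>M j\<in>{1..}. borel)"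
      by (intro measurable_restrict S) auto
    have \<Phi>S: "\<Phi> (\<lambda>j\<in>{1..}. S j \<omega>) = (\<lambda>t\<in>{0..}. renewal_count S t \<omega>)" for \<omega>
    proof -
      have "(\<Sum>j=1..n. (\<lambda>j\<in>{1..}. S j \<omega>) j) = (\<Sum>j=1..n. S j \<omega>)" for n
        by (intro sum.cong) auto
      then show ?thesis unfolding \<Phi>_def renewal_count_def by simp
    qed
    have "distr N (path_space (count_space UNIV)) (path_of Y)
      = distr N (path_space (count_space UNIV)) (\<Phi> \<circ> (\<lambda>\<omega>. \<lambda>j\<in>{1..}. S j \<omega>))"
    proof (intro distr_cong_AE path measurable_comp[OF seq \<Phi>] refl)
      show "AE \<omega> in N. path_of Y \<omega> = (\<Phi> \<circ> (\<lambda>\<omega>. \<lambda>j\<in>{1..}. S j \<omega>)) \<omega>"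
        unfolding path_of_def comp_def \<Phi>S using AE by eventually_elim (auto intro!: restrict_ext)
    qed
    also have "\<dots> = distr (distr N (\<Pi>\<^sub>M j\<in>{1..}. borel) (\<lambda>\<omega>. \<lambda>j\<in>{1..}. S j \<omega>)) (path_space (count_space UNIV)) \<Phi>"
      by (rule distr_distr[symmetric, OF \<Phi> seq])
    also have "distr N (\<Pi>\<^sub>M j\<in>{1..}. borel) (\<lambda>\<omega>. \<lambda>j\<in>{1..}. S j \<omega>) = (\<Pi>\<^sub>M j\<in>{1..}. distr N borel (S j))"
      using ind by (subst (asm) indep_vars_iff_distr_eq_PiM') (auto simp: S)
    finally show ?thesis .
  qed
  have "(\<Pi>\<^sub>M j\<in>{1..}. distr M borel (T j)) = (\<Pi>\<^sub>M j\<in>{1..}. distr M' borel (T' j))"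
    using law by (intro PiM_cong) auto
  then show ?thesis
    unfolding equal_in_law_def using *[OF M] *[OF M'] M(3) M'(3) by simp
qed

text \<open>Independence of the increments gives the product, and stationarity moves each increment
  to time 0. The times are deterministic; random epochs are inserted once the path of
  \<open>y\<close> is frozen.\<close>

lemma (in prob_space) nn_integral_levy_increments:
  fixes f :: "nat \<Rightarrow> real \<Rightarrow> ennreal"
  assumes levy: "levy_process X" and s: "0 \<le> s 0" "\<And>i. s i < s (Suc i)"
    and f[measurable]: "\<And>i. f i \<in> borel_measurable borel"
  shows "(\<integral>\<^sup>+\<omega>. (\<Prod>i<n. f i (X (s (Suc i)) \<omega> - X (s i) \<omega>)) \<partial>M)
    = (\<Prod>i<n. \<integral>\<^sup>+\<omega>. f i (X (s (Suc i) - s i) \<omega>) \<partial>M)"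
proof -
  have s_mono: "s i \<le> s (Suc i)" for i using s(2)[of i] by simp
  have s0: "0 \<le> s i" for i
  proof (induction i)
    case (Suc i)
    then show ?case using s_mono[of i] by linarith
  qed (rule s(1))
  have X[measurable]: "0 \<le> t \<Longrightarrow> random_variable borel (X t)" for t
    using levy by (auto simp: levy_process_def)
  have "indep_vars (\<lambda>_. borel) (\<lambda>i \<omega>. X (s (Suc i)) \<omega> - X (s i) \<omega>) {..<n}"
    using levy s by (auto simp: levy_process_def)
  then have "indep_vars (\<lambda>_. borel) (\<lambda>i \<omega>. f i (X (s (Suc i)) \<omega> - X (s i) \<omega>)) {..<n}"
    by (rule indep_vars_compose2) simp
  then have "(\<integral>\<^sup>+\<omega>. (\<Prod>i<n. f i (X (s (Suc i)) \<omega> - X (s i) \<omega>)) \<partial>M)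
    = (\<Prod>i<n. \<integral>\<^sup>+\<omega>. f i (X (s (Suc i)) \<omega> - X (s i) \<omega>) \<partial>M)"
    by (intro indep_vars_nn_integral) auto
  also have "\<dots> = (\<Prod>i<n. \<integral>\<^sup>+\<omega>. f i (X (s (Suc i) - s i) \<omega>) \<partial>M)"
  proof (intro prod.cong refl)
    fix i
    have "distr M borel (\<lambda>\<omega>. X (s i + (s (Suc i) - s i)) \<omega> - X (s i) \<omega>) = distr M borel (X (s (Suc i) - s i))"
    proof -
      have "0 \<le> s (Suc i) - s i" using s_mono[of i] by simp
      with levy s0[of i] show ?thesis unfolding levy_process_def by blast
    qed
    then have eq: "distr M borel (\<lambda>\<omega>. X (s (Suc i)) \<omega> - X (s i) \<omega>) = distr M borel (X (s (Suc i) - s i))"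
      by simp
    have "(\<integral>\<^sup>+\<omega>. f i (X (s (Suc i)) \<omega> - X (s i) \<omega>) \<partial>M)
      = (\<integral>\<^sup>+x. f i x \<partial>distr M borel (\<lambda>\<omega>. X (s (Suc i)) \<omega> - X (s i) \<omega>))"
      using s0 by (subst nn_integral_distr) auto
    also have "\<dots> = (\<integral>\<^sup>+\<omega>. f i (X (s (Suc i) - s i) \<omega>) \<partial>M)"
      unfolding eq using s_mono by (subst nn_integral_distr) auto
    finally show "(\<integral>\<^sup>+\<omega>. f i (X (s (Suc i)) \<omega> - X (s i) \<omega>) \<partial>M) = \<dots>" .
  qed
  finally show ?thesis .
qed

text \<open>Independence is given for the process \<open>y\<close>, not for its waiting times, so the renewal epochs have
  to be read off from the path of \<open>y\<close>; note that \<open>n - 1 < y q\<close> means \<open>n \<le> y q\<close>.\<close>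

definition jump_time :: "nat \<Rightarrow> (real \<Rightarrow> nat) \<Rightarrow> real" where
  "jump_time n p = rational_hitting_time (\<lambda>q. real (p q)) (real n - 1)"

lemma measurable_jump_time [measurable]:
  "jump_time n \<in> borel_measurable (path_space (count_space UNIV))"
  unfolding jump_time_def
proof (rule measurable_rational_hitting_time)
  fix q :: real assume "0 \<le> q"
  then have "(\<lambda>p. p q) \<in> measurable (path_space (count_space UNIV)) (count_space UNIV)"
    by (intro measurable_component_singleton) auto
  then show "(\<lambda>p. real (p q)) \<in> borel_measurable (path_space (count_space UNIV))"
    by (rule measurable_compose) simp
qed

locale subordinated_renewal = prob_space M for M :: "'a measure" +
  fixes \<beta> :: real and U :: "nat \<Rightarrow> 'a \<Rightarrow> real" and y :: "real \<Rightarrow> 'a \<Rightarrow> nat" and D :: "real \<Rightarrow> 'a \<Rightarrow> real"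
  assumes \<beta>: "0 < \<beta>"
    and U_indep: "indep_vars (\<lambda>_. borel) U {1..}"
    and U_pos: "\<And>j. 1 \<le> j \<Longrightarrow> AE \<omega> in M. 0 < U j \<omega>"
    and U_survival: "\<And>j t. 1 \<le> j \<Longrightarrow> 0 \<le> t \<Longrightarrow> prob {\<omega>\<in>space M. U j \<omega> > t} = exp (- t)"
    and y_eq: "\<And>t \<omega>. 0 \<le> t \<Longrightarrow> \<omega> \<in> space M \<Longrightarrow> y t \<omega> = renewal_count U t \<omega>"
    and D: "stable_subordinator \<beta> D"
    and indep: "independent_processes (count_space UNIV) y borel D"
begin

section \<open>Transforms and unboundedness of the Poisson epochs and of the subordinator\<close>

lemma U_measurable: "1 \<le> j \<Longrightarrow> random_variable borel (U j)"
  using U_indep by (auto simp: indep_vars_def)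

lemma D_measurable: "0 \<le> t \<Longrightarrow> random_variable borel (D t)"
  and D_zero: "AE \<omega> in M. D 0 \<omega> = 0"
  and D_levy: "levy_process D"
  and D_mono: "\<omega> \<in> space M \<Longrightarrow> mono_on {0..} (\<lambda>\<tau>. D \<tau> \<omega>)"
  and D_cadlag: "\<omega> \<in> space M \<Longrightarrow> cadlag_path (\<lambda>\<tau>. D \<tau> \<omega>)"
  using D unfolding stable_subordinator_def levy_process_def by blast+

lemma path_of_measurable [measurable]:
  "path_of y \<in> measurable M (path_space (count_space UNIV))"
  "path_of D \<in> measurable M (path_space borel)"
  using indep unfolding independent_processes_def by blast+

lemma grid_eval_D: "\<omega> \<in> space M \<Longrightarrow> 0 \<le> s \<Longrightarrow> grid_eval s (path_of D \<omega>) = D s \<omega>"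
  by (rule grid_eval_path_of[OF D_cadlag])

text \<open>The exponential law is the Mittag-Leffler law of order 1; the bound \<open>1 < l\<close>
  is inherited from \<open>laplace_mittag_leffler\<close>.\<close>

lemma nn_laplace_U:
  assumes "1 \<le> j" "1 < l"
  shows "(\<integral>\<^sup>+\<omega>. ennreal (exp (- (l * U j \<omega>))) \<partial>M) = ennreal (1 / (1 + l))"
proof -
  note [measurable] = U_measurable[OF assms(1)]
  have "expectation (\<lambda>\<omega>. exp (- (l * U j \<omega>))) = 1 / (1 + l powr 1)"
    using assms U_pos U_survival by (intro laplace_mittag_leffler) (auto simp: mittag_leffler_1)
  moreover have "AE \<omega> in M. norm (exp (- (l * U j \<omega>))) \<le> 1"
    using U_pos[OF assms(1)] by eventually_elim (use assms in auto)
  then have "integrable M (\<lambda>\<omega>. exp (- (l * U j \<omega>)))"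
    by (rule integrable_const_bound) simp
  ultimately show ?thesis
    using assms by (subst nn_integral_eq_integral) auto
qed

lemma nn_laplace_D:
  assumes "0 \<le> l" "0 \<le> \<tau>"
  shows "(\<integral>\<^sup>+\<omega>. ennreal (exp (- (l * D \<tau> \<omega>))) \<partial>M) = ennreal (exp (- \<tau> * l powr \<beta>))"
proof -
  note [measurable] = D_measurable[OF assms(2)]
  have "AE \<omega> in M. norm (exp (- (l * D \<tau> \<omega>))) \<le> 1"
    using D_zero AE_space
  proof eventually_elim
    fix \<omega> assume "D 0 \<omega> = 0" "\<omega> \<in> space M"
    then have "0 \<le> D \<tau> \<omega>" using mono_onD[OF D_mono, of \<omega> 0 \<tau>] assms by simp
    then show "norm (exp (- (l * D \<tau> \<omega>))) \<le> 1" using assms by simp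
  qed
  then have "integrable M (\<lambda>\<omega>. exp (- (l * D \<tau> \<omega>)))"
    by (rule integrable_const_bound) simp
  moreover have "expectation (\<lambda>\<omega>. exp (- (l * D \<tau> \<omega>))) = exp (- \<tau> * l powr \<beta>)"
    using D assms by (simp add: stable_subordinator_def)
  ultimately show ?thesis
    by (subst nn_integral_eq_integral) auto
qed

lemma sum_U_unbounded: "AE \<omega> in M. \<forall>K. \<exists>n. K < (\<Sum>j=1..n. U j \<omega>)"
\<comment> \<open>\<open>nn_laplace_U\<close> asks for an argument above 1; at 2 each waiting time
  contributes a factor 1/3.\<close>
proof (rule AE_unbounded_of_laplace[where c = 2])
  fix n
  show "random_variable borel (\<lambda>\<omega>. \<Sum>j=1..n. U j \<omega>)"
    by (intro borel_measurable_sum U_measurable) auto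
next
  have "(\<integral>\<^sup>+\<omega>. ennreal (exp (- (2 * (\<Sum>j=1..n. U j \<omega>)))) \<partial>M) = ennreal ((1 / 3) ^ n)" for n
  proof -
    have "ennreal (exp (- (2 * (\<Sum>j=1..n. U j \<omega>)))) = (\<Prod>j=1..n. ennreal (exp (- (2 * U j \<omega>))))" for \<omega>
      by (simp add: prod_ennreal exp_sum[symmetric] sum_distrib_left sum_negf)
    moreover have "indep_vars (\<lambda>_. borel) (\<lambda>j \<omega>. ennreal (exp (- (2 * U j \<omega>)))) {1..n}"
      by (rule indep_vars_compose2[OF indep_vars_subset[OF U_indep]]) auto
    ultimately have "(\<integral>\<^sup>+\<omega>. ennreal (exp (- (2 * (\<Sum>j=1..n. U j \<omega>)))) \<partial>M)
        = (\<Prod>j=1..n. \<integral>\<^sup>+\<omega>. ennreal (exp (- (2 * U j \<omega>))) \<partial>M)"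
      by (simp add: indep_vars_nn_integral)
    also have "\<dots> = (\<Prod>j=1..n. ennreal (1 / 3))"
      by (intro prod.cong refl, subst nn_laplace_U) auto
    finally show ?thesis by (simp add: ennreal_power)
  qed
  moreover have "(\<lambda>n. ennreal ((1 / 3) ^ n)) \<longlonglongrightarrow> ennreal 0"
    by (intro tendsto_ennrealI LIMSEQ_power_zero) auto
  ultimately show "(\<lambda>n. \<integral>\<^sup>+\<omega>. ennreal (exp (- (2 * (\<Sum>j=1..n. U j \<omega>)))) \<partial>M) \<longlonglongrightarrow> 0"
    by simp
qed simp

lemma D_unbounded: "AE \<omega> in M. \<forall>K. \<exists>n::nat. K < D (real n) \<omega>"
proof (rule AE_unbounded_of_laplace[where c = 1])
  have "(\<lambda>n. exp (- 1) ^ n :: real) \<longlonglongrightarrow> 0"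
    by (intro LIMSEQ_power_zero) auto
  then have "(\<lambda>n. ennreal (exp (- real n))) \<longlonglongrightarrow> ennreal 0"
    by (intro tendsto_ennrealI) (simp add: exp_of_nat_mult[symmetric])
  moreover have "(\<integral>\<^sup>+\<omega>. ennreal (exp (- (1 * D (real n) \<omega>))) \<partial>M) = ennreal (exp (- real n))" for n
    by (subst nn_laplace_D) auto
  ultimately show "(\<lambda>n. \<integral>\<^sup>+\<omega>. ennreal (exp (- (1 * D (real n) \<omega>))) \<partial>M) \<longlonglongrightarrow> 0"
    by simp
qed (auto intro: D_measurable)

section \<open>Joint law of the waiting times of the time-changed process\<close>

lemma AE_jump_time:
  "AE \<omega> in M. (\<forall>j\<ge>1. 0 < U j \<omega>) \<and> (\<forall>n. jump_time n (path_of y \<omega>) = (\<Sum>j=1..n. U j \<omega>))"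
proof -
  have "AE \<omega> in M. \<forall>j. 1 \<le> j \<longrightarrow> 0 < U j \<omega>"
    using U_pos by (simp add: AE_all_countable)
  then show ?thesis
    using sum_U_unbounded AE_space
  proof eventually_elim
    case (elim \<omega>)
    have "jump_time n (path_of y \<omega>) = (\<Sum>j=1..n. U j \<omega>)" for n
    proof -
      have "jump_time n (path_of y \<omega>) = rational_hitting_time (\<lambda>q. real (y q \<omega>)) (real n - 1)"
        unfolding jump_time_def by (intro rational_hitting_time_cong) (simp add: path_of_def)
      also have "\<dots> = (\<Sum>j=1..n. U j \<omega>)"
      proof (rule rational_hitting_time_jump)
        show "0 \<le> (\<Sum>j=1..n. U j \<omega>)"
          using elim(1) by (intro sum_nonneg) (auto intro: less_imp_le)
        fix t :: real assume "0 \<le> t"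
        then show "n \<le> y t \<omega> \<longleftrightarrow> (\<Sum>j=1..n. U j \<omega>) \<le> t"
          using elim by (subst y_eq, simp, simp, intro le_renewal_count_iff) auto
      qed
      finally show ?thesis .
    qed
    with elim(1) show ?case by blast
  qed
qed

text \<open>Almost surely the increment of D between consecutive epochs. It is written through
  \<open>jump_time\<close> and \<open>grid_eval\<close> so that it is a measurable functional of the
  two paths, to which independence applies. Truncated subtraction makes \<open>W 0\<close> zero;
  only indices from 1 on matter.\<close>

definition W :: "nat \<Rightarrow> 'a \<Rightarrow> real" where
  "W j \<omega> = grid_eval (jump_time j (path_of y \<omega>)) (path_of D \<omega>)
    - grid_eval (jump_time (j - 1) (path_of y \<omega>)) (path_of D \<omega>)"

text \<open>The factor \<open>c\<close> serves to evaluate D shortly before an epoch, in the study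
  of left limits.\<close>

lemma grid_eval_jump_measurable [measurable]:
  "(\<lambda>z. grid_eval (jump_time n (fst z) * c) (snd z))
     \<in> borel_measurable (path_space (count_space UNIV) \<Otimes>\<^sub>M path_space borel)"
  "(\<lambda>z. grid_eval (jump_time n (fst z)) (snd z))
     \<in> borel_measurable (path_space (count_space UNIV) \<Otimes>\<^sub>M path_space borel)"
proof -
  have "(\<lambda>z. (jump_time n (fst z) * c, snd z)) \<in> (path_space (count_space UNIV) \<Otimes>\<^sub>M path_space borel)
      \<rightarrow>\<^sub>M (borel \<Otimes>\<^sub>M path_space borel)" for c
    by measurable
  from measurable_compose[OF this measurable_grid_eval]
  show *: "(\<lambda>z. grid_eval (jump_time n (fst z) * c) (snd z))
     \<in> borel_measurable (path_space (count_space UNIV) \<Otimes>\<^sub>M path_space borel)" for c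
    by simp
  show "(\<lambda>z. grid_eval (jump_time n (fst z)) (snd z))
     \<in> borel_measurable (path_space (count_space UNIV) \<Otimes>\<^sub>M path_space borel)"
    using *[of 1] by simp
qed

lemma W_measurable [measurable]: "random_variable borel (W j)"
proof -
  have p: "(\<lambda>\<omega>. (path_of y \<omega>, path_of D \<omega>)) \<in> measurable M (path_space (count_space UNIV) \<Otimes>\<^sub>M path_space borel)"
    by measurable
  have "(\<lambda>\<omega>. grid_eval (jump_time n (path_of y \<omega>)) (path_of D \<omega>)) \<in> borel_measurable M" for n
    using measurable_compose[OF p grid_eval_jump_measurable(2)[of n]] by simp
  then show ?thesis unfolding W_def by measurable
qed

text \<open>The expectation of f at D evaluated at the time \<open>U j\<close>, with D taken from an
  independent copy of the probability space.\<close>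

definition mixture :: "(real \<Rightarrow> ennreal) \<Rightarrow> nat \<Rightarrow> ennreal" where
  "mixture f j = (\<integral>\<^sup>+\<omega>. \<integral>\<^sup>+\<omega>'. f (grid_eval (U j \<omega>) (path_of D \<omega>')) \<partial>M \<partial>M)"

text \<open>Arbitrary test functions are allowed because the identity is used twice: indicators
  yield independence of the \<open>W j\<close>, exponentials their Laplace transform.\<close>

lemma nn_integral_prod_W:
  fixes f :: "nat \<Rightarrow> real \<Rightarrow> ennreal"
  assumes [measurable]: "\<And>j. f j \<in> borel_measurable borel"
  shows "(\<integral>\<^sup>+\<omega>. (\<Prod>j=1..n. f j (W j \<omega>)) \<partial>M) = (\<Prod>j=1..n. mixture (f j) j)"
proof -
  define F where "F z = (\<Prod>j=1..n. f j (grid_eval (jump_time j (fst z)) (snd z)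
     - grid_eval (jump_time (j - 1) (fst z)) (snd z)))" for z
  have F: "F \<in> borel_measurable (path_space (count_space UNIV) \<Otimes>\<^sub>M path_space borel)"
    unfolding F_def by measurable
  define \<kappa> where "\<kappa> j u = (\<integral>\<^sup>+\<omega>'. f j (grid_eval u (path_of D \<omega>')) \<partial>M)" for j u
  have [measurable]: "\<kappa> j \<in> borel_measurable borel" for j
  proof -
    have "(\<lambda>z. (fst z, path_of D (snd z))) \<in> (borel \<Otimes>\<^sub>M M) \<rightarrow>\<^sub>M (borel \<Otimes>\<^sub>M path_space borel)"
      by measurable
    from measurable_compose[OF measurable_compose[OF this measurable_grid_eval], of "f j"]
    show ?thesis unfolding \<kappa>_def by (intro borel_measurable_nn_integral) (simp add: case_prod_beta)
  qed
  have "(\<integral>\<^sup>+\<omega>. (\<Prod>j=1..n. f j (W j \<omega>)) \<partial>M) = (\<integral>\<^sup>+\<omega>. F (path_of y \<omega>, path_of D \<omega>) \<partial>M)"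
    by (simp add: F_def W_def)
  also have "\<dots> = (\<integral>\<^sup>+\<omega>. \<integral>\<^sup>+\<omega>'. F (path_of y \<omega>, path_of D \<omega>') \<partial>M \<partial>M)"
    by (rule nn_integral_independent_processes[OF indep F])
  also have "\<dots> = (\<integral>\<^sup>+\<omega>. (\<Prod>j=1..n. \<kappa> j (U j \<omega>)) \<partial>M)"
  proof (rule nn_integral_cong_AE)
    show "AE \<omega> in M. (\<integral>\<^sup>+\<omega>'. F (path_of y \<omega>, path_of D \<omega>') \<partial>M) = (\<Prod>j=1..n. \<kappa> j (U j \<omega>))"
      using AE_jump_time
    proof eventually_elim
      case (elim \<omega>)
      define s where "s i = (\<Sum>j=1..i. U j \<omega>)" for i
      have s0: "0 \<le> s i" for i unfolding s_def using elim by (intro sum_nonneg) (auto intro: less_imp_le)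
      have "(\<integral>\<^sup>+\<omega>'. F (path_of y \<omega>, path_of D \<omega>') \<partial>M)
        = (\<integral>\<^sup>+\<omega>'. (\<Prod>i<n. f (Suc i) (D (s (Suc i)) \<omega>' - D (s i) \<omega>')) \<partial>M)"
        unfolding F_def using elim s0
        by (intro nn_integral_cong) (simp add: grid_eval_D s_def prod.atLeast1_atMost_eq)
      also have "\<dots> = (\<Prod>i<n. \<integral>\<^sup>+\<omega>'. f (Suc i) (D (s (Suc i) - s i) \<omega>') \<partial>M)"
        using elim by (intro nn_integral_levy_increments[OF D_levy]) (auto simp: s_def)
      also have "\<dots> = (\<Prod>i<n. \<kappa> (Suc i) (U (Suc i) \<omega>))"
        using elim unfolding \<kappa>_def
        by (intro prod.cong refl nn_integral_cong) (simp add: s_def grid_eval_D less_imp_le)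
      finally show ?case by (simp add: prod.atLeast1_atMost_eq)
    qed
  qed
  also have "\<dots> = (\<Prod>j=1..n. \<integral>\<^sup>+\<omega>. \<kappa> j (U j \<omega>) \<partial>M)"
  proof (rule indep_vars_nn_integral)
    show "indep_vars (\<lambda>_. borel) (\<lambda>j \<omega>. \<kappa> j (U j \<omega>)) {1..n}"
      by (rule indep_vars_compose2[OF indep_vars_subset[OF U_indep]]) auto
  qed auto
  finally show ?thesis by (simp add: mixture_def \<kappa>_def)
qed

lemma nn_integral_W:
  fixes f :: "real \<Rightarrow> ennreal"
  assumes [measurable]: "f \<in> borel_measurable borel" and j: "1 \<le> j"
  shows "(\<integral>\<^sup>+\<omega>. f (W j \<omega>) \<partial>M) = mixture f j"
proof -
  \<comment> \<open>A marginal is the product formula with all other test functions equal to 1,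
    whose mixtures are 1.\<close>
  let ?f = "\<lambda>i. if i = j then f else (\<lambda>_. 1)"
  have "(\<integral>\<^sup>+\<omega>. (\<Prod>i=1..j. ?f i (W i \<omega>)) \<partial>M) = (\<Prod>i=1..j. mixture (?f i) i)"
    by (rule nn_integral_prod_W) auto
  moreover have "(\<Prod>i=1..j. ?f i (W i \<omega>)) = (\<Prod>i=1..j. if i = j then f (W j \<omega>) else 1)" for \<omega>
    by (intro prod.cong) auto
  moreover have "(\<Prod>i=1..j. mixture (?f i) i) = (\<Prod>i=1..j. if i = j then mixture f j else 1)"
    by (intro prod.cong) (auto simp: mixture_def emeasure_space_1)
  ultimately show ?thesis using j by (simp add: prod.delta)
qed

lemma W_indep: "indep_vars (\<lambda>_. borel) W {1..}"
  unfolding indep_vars_def2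
proof (intro conjI ballI W_measurable)
  show "indep_sets (\<lambda>j. {W j -` A \<inter> space M |A. A \<in> sets borel}) {1..}"
    unfolding indep_sets_def
  proof (intro conjI ballI allI impI)
    fix j show "{W j -` A \<inter> space M |A. A \<in> sets borel} \<subseteq> events"
      using measurable_sets[OF W_measurable] by auto
  next
    fix J :: "nat set" and A
    assume J: "J \<subseteq> {1..}" "J \<noteq> {}" "finite J" and A: "A \<in> Pi J (\<lambda>j. {W j -` A \<inter> space M |A. A \<in> sets borel})"
    from A have "\<forall>j\<in>J. A j \<in> {W j -` B \<inter> space M |B. B \<in> sets borel}" unfolding Pi_iff .
    then have "\<forall>j\<in>J. \<exists>B. B \<in> sets borel \<and> A j = W j -` B \<inter> space M" by blast
    then obtain B where B: "\<And>j. j \<in> J \<Longrightarrow> B j \<in> sets borel" "\<And>j. j \<in> J \<Longrightarrow> A j = W j -` B j \<inter> space M"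
      by metis
    \<comment> \<open>The product formula covers only full ranges 1..n. Indices outside J receive
      the constant 1, so the range up to \<open>Max J\<close> represents the intersection over
      J.\<close>
    define f :: "nat \<Rightarrow> real \<Rightarrow> ennreal" where "f j = (if j \<in> J then indicator (B j) else (\<lambda>_. 1))" for j
    have f[measurable]: "f j \<in> borel_measurable borel" for j
      using B(1)[of j] by (auto simp: f_def)
    define n where "n = Max J"
    have Jn: "{Suc 0..n} \<inter> J = J" using J by (auto simp: n_def)
    have A': "A j \<in> events" if "j \<in> J" for j
      using measurable_sets[OF W_measurable B(1)[OF that]] B(2)[OF that] by simp
    have "(\<integral>\<^sup>+\<omega>. (\<Prod>j=1..n. f j (W j \<omega>)) \<partial>M) = (\<Prod>j=1..n. \<integral>\<^sup>+\<omega>. f j (W j \<omega>) \<partial>M)"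
      unfolding nn_integral_prod_W[of f, OF f] by (intro prod.cong refl nn_integral_W[symmetric]) auto
    moreover have "(\<integral>\<^sup>+\<omega>. (\<Prod>j=1..n. f j (W j \<omega>)) \<partial>M) = emeasure M (\<Inter>j\<in>J. A j)"
    proof -
      have "(\<integral>\<^sup>+\<omega>. (\<Prod>j=1..n. f j (W j \<omega>)) \<partial>M) = (\<integral>\<^sup>+\<omega>. indicator (\<Inter>j\<in>J. A j) \<omega> \<partial>M)"
      proof (intro nn_integral_cong)
        fix \<omega> assume "\<omega> \<in> space M"
        have "(\<Prod>j=1..n. f j (W j \<omega>)) = (\<Prod>j\<in>{1..n}. if j \<in> J then indicator (A j) \<omega> else 1)"
          using \<open>\<omega> \<in> space M\<close> by (intro prod.cong refl) (auto simp: f_def B(2) indicator_def)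
        also have "\<dots> = (\<Prod>j\<in>J. indicator (A j) \<omega>)"
          by (simp add: prod.inter_restrict[symmetric] Jn)
        also have "\<dots> = indicator (\<Inter>j\<in>J. A j) \<omega>"
          using J(3) by (auto simp: indicator_def prod_zero_iff)
        finally show "(\<Prod>j=1..n. f j (W j \<omega>)) = indicator (\<Inter>j\<in>J. A j) \<omega>" .
      qed
      then show ?thesis using J A' by (simp add: sets.finite_INT)
    qed
    moreover have "(\<Prod>j=1..n. \<integral>\<^sup>+\<omega>. f j (W j \<omega>) \<partial>M) = (\<Prod>j\<in>J. emeasure M (A j))"
    proof -
      have "(\<Prod>j=1..n. \<integral>\<^sup>+\<omega>. f j (W j \<omega>) \<partial>M) = (\<Prod>j\<in>{1..n}. if j \<in> J then emeasure M (A j) else 1)"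
      proof (intro prod.cong refl)
        fix j
        show "(\<integral>\<^sup>+\<omega>. f j (W j \<omega>) \<partial>M) = (if j \<in> J then emeasure M (A j) else 1)"
        proof (cases "j \<in> J")
          case True
          then have "(\<integral>\<^sup>+\<omega>. f j (W j \<omega>) \<partial>M) = (\<integral>\<^sup>+\<omega>. indicator (A j) \<omega> \<partial>M)"
            by (intro nn_integral_cong) (auto simp: f_def B(2) indicator_def)
          then show ?thesis using True A' by simp
        qed (simp add: f_def emeasure_space_1)
      qed
      then show ?thesis by (simp add: prod.inter_restrict[symmetric] Jn)
    qed
    ultimately have "emeasure M (\<Inter>j\<in>J. A j) = (\<Prod>j\<in>J. emeasure M (A j))"
      by simp
    then show "prob (\<Inter>j\<in>J. A j) = (\<Prod>j\<in>J. prob (A j))"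
      by (simp add: emeasure_eq_measure prod_ennreal prod_nonneg)
  qed
qed

lemma W_nonneg:
  assumes "1 \<le> j"
  shows "AE \<omega> in M. 0 \<le> W j \<omega>"
  using AE_jump_time AE_space
proof eventually_elim
  case (elim \<omega>)
  have "0 \<le> (\<Sum>i=1..j - 1. U i \<omega>)"
    using elim by (intro sum_nonneg) (auto intro: less_imp_le)
  moreover have "(\<Sum>i=1..j - 1. U i \<omega>) \<le> (\<Sum>i=1..j. U i \<omega>)"
    using elim by (intro sum_mono2) (auto intro: less_imp_le)
  ultimately show ?case
    using elim mono_onD[OF D_mono, of \<omega> "\<Sum>i=1..j - 1. U i \<omega>" "\<Sum>i=1..j. U i \<omega>"]
    by (simp add: W_def grid_eval_D)
qed

text \<open>D at time u has transform exp (-u l^\<beta>), so W has the transform of an exponential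
  variable at l^\<beta>. The condition \<open>1 < l\<close> keeps l^\<beta> above 1, in the range of
  \<open>nn_laplace_U\<close>.\<close>

lemma laplace_W:
  assumes j: "1 \<le> j" and l: "1 < l"
  shows "expectation (\<lambda>\<omega>. exp (- (l * W j \<omega>))) = 1 / (1 + l powr \<beta>)"
proof -
  have l\<beta>: "1 < l powr \<beta>" using l \<beta> by simp
  have "(\<integral>\<^sup>+\<omega>. ennreal (exp (- (l * W j \<omega>))) \<partial>M) = mixture (\<lambda>x. ennreal (exp (- (l * x)))) j"
    by (rule nn_integral_W) (use j in auto)
  also have "\<dots> = (\<integral>\<^sup>+\<omega>. ennreal (exp (- (l powr \<beta> * U j \<omega>))) \<partial>M)"
    unfolding mixture_def
  proof (rule nn_integral_cong_AE)
    show "AE \<omega> in M. (\<integral>\<^sup>+\<omega>'. ennreal (exp (- (l * grid_eval (U j \<omega>) (path_of D \<omega>')))) \<partial>M)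
        = ennreal (exp (- (l powr \<beta> * U j \<omega>)))"
      using U_pos[OF j]
    proof eventually_elim
      case (elim \<omega>)
      have "(\<integral>\<^sup>+\<omega>'. ennreal (exp (- (l * grid_eval (U j \<omega>) (path_of D \<omega>')))) \<partial>M)
          = (\<integral>\<^sup>+\<omega>'. ennreal (exp (- (l * D (U j \<omega>) \<omega>'))) \<partial>M)"
        using elim by (intro nn_integral_cong) (simp add: grid_eval_D)
      also have "\<dots> = ennreal (exp (- (l powr \<beta> * U j \<omega>)))"
        using elim l by (subst nn_laplace_D) (auto simp: mult.commute)
      finally show ?case .
    qed
  qed
  also have "\<dots> = ennreal (1 / (1 + l powr \<beta>))"
    by (rule nn_laplace_U[OF j l\<beta>])
  finally show ?thesis
    using l\<beta> by (subst (asm) nn_integral_eq_integrable) auto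
qed

section \<open>Absence of jumps of D at fixed times and at the epochs of y\<close>

lemma D_left_continuous:
  assumes s: "0 < s"
  shows "AE \<omega> in M. \<forall>k::nat. \<exists>m::nat. D s \<omega> - 1 / real (Suc k) < D (s * (1 - 1 / real (m + 2))) \<omega>"
  unfolding AE_all_countable
proof
  fix k :: nat
  \<comment> \<open>The shift by 2 keeps every \<open>a m\<close> in [s/2, s), hence nonnegative and
    different from s.\<close>
  define a where "a m = s * (1 - 1 / real (m + 2))" for m :: nat
  have a: "0 \<le> a m" for m using s by (simp add: a_def field_simps)
  note [measurable] = D_measurable[OF a] D_measurable[OF less_imp_le[OF s]]
  let ?A = "{\<omega>\<in>space M. \<forall>m. D (a m) \<omega> \<le> D s \<omega> - 1 / real (Suc k)}"
  \<comment> \<open>Stochastic continuity uses a strict inequality; a gap of at least 1 / (k + 1)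
    strictly exceeds this smaller threshold.\<close>
  let ?B = "\<lambda>t. {\<omega>\<in>space M. \<bar>D t \<omega> - D s \<omega>\<bar> > 1 / real (k + 2)}"
  have A: "?A \<in> events" by measurable
  have "a \<longlonglongrightarrow> s * (1 - 0)"
    unfolding a_def using LIMSEQ_ignore_initial_segment[OF lim_1_over_n, of 2] by (intro tendsto_intros) auto
  then have "filterlim a (at s within {0..}) sequentially"
    using a s by (auto simp: filterlim_at a_def intro!: always_eventually)
  moreover have "((\<lambda>t. prob (?B t)) \<longlongrightarrow> 0) (at s within {0..})"
    using D_levy s unfolding levy_process_def by simp
  ultimately have lim: "(\<lambda>m. prob (?B (a m))) \<longlonglongrightarrow> 0"
    by (rule filterlim_compose[rotated])
  \<comment> \<open>The event of a left gap at s lies in every \<open>?B (a m)\<close>, and these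
    probabilities tend to 0.\<close>
  have "prob ?A \<le> prob (?B (a m))" for m
  proof (rule finite_measure_mono)
    have "1 / real (k + 2) < 1 / real (Suc k)" by (simp add: field_simps)
    then show "?A \<subseteq> ?B (a m)" by (auto dest!: spec[of _ m])
  qed measurable
  then have "prob ?A \<le> 0"
    by (intro LIMSEQ_le_const[OF lim]) auto
  then have "prob ?A = 0" using measure_nonneg[of M ?A] by linarith
  then have "AE \<omega> in M. \<omega> \<notin> ?A"
    using A by (intro AE_not_in) (simp add: null_sets_def emeasure_eq_measure)
  then show "AE \<omega> in M. \<exists>m. D s \<omega> - 1 / real (Suc k) < D (s * (1 - 1 / real (m + 2))) \<omega>"
    using AE_space by eventually_elim (auto simp: a_def not_le)
qed

text \<open>An epoch \<open>s\<close> of \<open>y\<close> satisfies \<open>s \<le> t\<^sub>*(t)\<close> iff the left limit of \<open>D\<close> at \<open>s\<close> is at most \<open>t\<close>.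
  Independence excludes that \<open>D\<close> jumps at an epoch, so the left limit may be replaced by \<open>D s\<close>.\<close>

lemma AE_D_left_continuous_jump:
  assumes n: "1 \<le> n"
  shows "AE \<omega> in M. \<forall>k::nat. \<exists>m::nat. D (\<Sum>j=1..n. U j \<omega>) \<omega> - 1 / real (Suc k)
    < D ((\<Sum>j=1..n. U j \<omega>) * (1 - 1 / real (m + 2))) \<omega>"
proof -
  define P where "P z \<longleftrightarrow> (\<forall>k::nat. \<exists>m::nat. grid_eval (jump_time n (fst z)) (snd z) - 1 / real (Suc k)
      < grid_eval (jump_time n (fst z) * (1 - 1 / real (m + 2))) (snd z))" for z
  \<comment> \<open>The indicator of failure: its expectation can be computed with y frozen, and
    value 0 gives \<open>P\<close> almost surely.\<close>
  define F :: "_ \<Rightarrow> ennreal" where "F z = (if P z then 0 else 1)" for z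
  have [measurable]: "Measurable.pred (path_space (count_space UNIV) \<Otimes>\<^sub>M path_space borel) P"
    unfolding P_def by measurable
  have F: "F \<in> borel_measurable (path_space (count_space UNIV) \<Otimes>\<^sub>M path_space borel)"
    unfolding F_def by measurable
  have eq: "P (path_of y \<omega>, path_of D \<omega>') \<longleftrightarrow> (\<forall>k::nat. \<exists>m::nat. D (\<Sum>j=1..n. U j \<omega>) \<omega>' - 1 / real (Suc k)
    < D ((\<Sum>j=1..n. U j \<omega>) * (1 - 1 / real (m + 2))) \<omega>')"
    if "(\<forall>j\<ge>1. 0 < U j \<omega>) \<and> (\<forall>n. jump_time n (path_of y \<omega>) = (\<Sum>j=1..n. U j \<omega>))" "\<omega>' \<in> space M" for \<omega> \<omega>'
  proof -
    have "0 \<le> (\<Sum>j=1..n. U j \<omega>)" using that by (intro sum_nonneg) (auto intro: less_imp_le)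
    moreover from this have "0 \<le> (\<Sum>j=1..n. U j \<omega>) * (1 - 1 / real (m + 2))" for m :: nat
      by (intro mult_nonneg_nonneg) auto
    ultimately show ?thesis
      unfolding P_def using that by (simp add: grid_eval_D)
  qed
  have "(\<integral>\<^sup>+\<omega>. F (path_of y \<omega>, path_of D \<omega>) \<partial>M) = (\<integral>\<^sup>+\<omega>. \<integral>\<^sup>+\<omega>'. F (path_of y \<omega>, path_of D \<omega>') \<partial>M \<partial>M)"
    by (rule nn_integral_independent_processes[OF indep F])
  also have "\<dots> = (\<integral>\<^sup>+\<omega>. 0 \<partial>M)"
  proof (rule nn_integral_cong_AE)
    show "AE \<omega> in M. (\<integral>\<^sup>+\<omega>'. F (path_of y \<omega>, path_of D \<omega>') \<partial>M) = 0"
      using AE_jump_time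
    proof eventually_elim
      case (elim \<omega>)
      \<comment> \<open>With \<omega> frozen the epoch is a fixed positive time for the copy
        \<omega>', so \<open>D_left_continuous\<close> applies.\<close>
      have "0 < (\<Sum>j=1..n. U j \<omega>)" using elim n by (intro sum_pos) auto
      from D_left_continuous[OF this] AE_space
      have "AE \<omega>' in M. F (path_of y \<omega>, path_of D \<omega>') = 0"
        by eventually_elim (simp add: F_def eq[OF elim])
      then have "(\<integral>\<^sup>+\<omega>'. F (path_of y \<omega>, path_of D \<omega>') \<partial>M) = (\<integral>\<^sup>+\<omega>'. 0 \<partial>M)"
        by (rule nn_integral_cong_AE)
      then show ?case by simp
    qed
  qed
  finally have "(\<integral>\<^sup>+\<omega>. F (path_of y \<omega>, path_of D \<omega>) \<partial>M) = 0" by simp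
  then have "AE \<omega> in M. F (path_of y \<omega>, path_of D \<omega>) = 0"
    by (subst (asm) nn_integral_0_iff_AE) (use F in measurable)
  then show ?thesis
    using AE_jump_time AE_space
    by eventually_elim (simp add: F_def eq split: if_splits)
qed

section \<open>Pathwise identification of the time-changed process as a renewal count\<close>

lemma y_time_change_measurable:
  assumes "0 \<le> t"
  shows "(\<lambda>\<omega>. y (inverse_process D t \<omega>) \<omega>) \<in> measurable M (count_space UNIV)"
proof -
  let ?L = "\<lambda>\<omega>. rational_hitting_time (\<lambda>\<tau>. D \<tau> \<omega>) t"
  have "(\<lambda>\<omega>. renewal_count U (?L \<omega>) \<omega>) \<in> measurable M (count_space UNIV)"
    by (intro measurable_renewal_count U_measurable measurable_rational_hitting_time D_measurable)
  \<comment> \<open>\<open>y_eq\<close> holds at every point for all times, so a random time may be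
    substituted; measurability of each single \<open>y t\<close> would not allow this.\<close>
  moreover have "y (inverse_process D t \<omega>) \<omega> = renewal_count U (?L \<omega>) \<omega>" if "\<omega> \<in> space M" for \<omega>
    using that by (simp add: inverse_process_eq_rational_hitting_time[OF D_mono] y_eq rational_hitting_time_nonneg)
  ultimately show ?thesis by (subst measurable_cong) auto
qed

lemma AE_y_time_change:
  "AE \<omega> in M. \<forall>t\<ge>0. y (inverse_process D t \<omega>) \<omega> = renewal_count W t \<omega>"
proof -
  have "AE \<omega> in M. \<forall>n. 1 \<le> n \<longrightarrow> (\<forall>k::nat. \<exists>m::nat. D (\<Sum>j=1..n. U j \<omega>) \<omega> - 1 / real (Suc k)
    < D ((\<Sum>j=1..n. U j \<omega>) * (1 - 1 / real (m + 2))) \<omega>)"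
    using AE_D_left_continuous_jump by (simp add: AE_all_countable)
  then show ?thesis
    using AE_jump_time D_unbounded D_zero AE_space
  proof eventually_elim
    case (elim \<omega>)
    define S where "S n = (\<Sum>j=1..n. U j \<omega>)" for n
    have S0: "0 \<le> S n" for n
      unfolding S_def using elim by (intro sum_nonneg) (auto intro: less_imp_le)
    have "W j \<omega> = D (S j) \<omega> - D (S (j - 1)) \<omega>" for j
      using elim S0 by (simp add: W_def grid_eval_D S_def)
    then have "(\<Sum>j=1..n. W j \<omega>) = (\<Sum>i<n. D (S (Suc i)) \<omega> - D (S i) \<omega>)" for n
      by (simp add: sum.atLeast1_atMost_eq)
    \<comment> \<open>The telescope leaves the term at S 0 = 0, where D vanishes almost
      surely.\<close>
    also have "(\<Sum>i<n. D (S (Suc i)) \<omega> - D (S i) \<omega>) = D (S n) \<omega>" for n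
      using elim by (subst sum_lessThan_telescope) (simp add: S_def)
    finally have sumW: "(\<Sum>j=1..n. W j \<omega>) = D (S n) \<omega>" for n .
    show ?case
    proof (intro allI impI)
      fix t :: real assume t: "0 \<le> t"
      have "S n \<le> inverse_process D t \<omega> \<longleftrightarrow> D (S n) \<omega> \<le> t" for n
      proof (rule le_inverse_process_iff)
        show "mono_on {0..} (\<lambda>\<tau>. D \<tau> \<omega>)" using elim by (intro D_mono)
        show "D 0 \<omega> \<le> t" using elim t by simp
        obtain m where "t < D (real m) \<omega>" using elim by blast
        then show "\<exists>\<tau>\<ge>0. t < D \<tau> \<omega>" by (intro exI[of _ "real m"]) simp
        fix e :: real assume Sn: "0 < S n" and e: "0 < e"
        from Sn have "1 \<le> n" by (cases n) (auto simp: S_def)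
        obtain k where k: "1 / real (Suc k) < e" using e nat_approx_posE by blast
        obtain m where "D (S n) \<omega> - 1 / real (Suc k) < D (S n * (1 - 1 / real (m + 2))) \<omega>"
          using elim(1) \<open>1 \<le> n\<close> unfolding S_def by blast
        then show "\<exists>\<tau>\<ge>0. \<tau> < S n \<and> D (S n) \<omega> - e < D \<tau> \<omega>"
          using k Sn by (intro exI[of _ "S n * (1 - 1 / real (m + 2))"] conjI) (linarith | simp add: field_simps)+
      qed (rule S0)
      moreover have "0 \<le> inverse_process D t \<omega>"
        using elim by (simp add: inverse_process_eq_rational_hitting_time[OF D_mono] rational_hitting_time_nonneg)
      \<comment> \<open>Both counts are now \<open>Max\<close> of one and the same set of
        indices.\<close>
      ultimately show "y (inverse_process D t \<omega>) \<omega> = renewal_count W t \<omega>"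
        using elim by (simp only: y_eq renewal_count_def sumW S_def[symmetric])
    qed
  qed
qed

end

theorem mainTheorem1:
  fixes \<beta> :: real
    and M :: "'a measure" and y :: "real \<Rightarrow> 'a \<Rightarrow> nat" and D :: "real \<Rightarrow> 'a \<Rightarrow> real"
    and M' :: "'b measure" and x :: "real \<Rightarrow> 'b \<Rightarrow> nat"
  assumes "0 < \<beta>" and "\<beta> \<le> 1"
    and "prob_space M" and "prob_space M'"
    and "prob_space.standard_poisson_process M y"
    and "prob_space.stable_subordinator M \<beta> D"
    and "prob_space.independent_processes M (count_space UNIV) y borel D"
    and "prob_space.fractional_poisson_process M' \<beta> x"
  shows "equal_in_law (count_space UNIV)
           M' x
           M (\<lambda>t \<omega>. y (inverse_process D t \<omega>) \<omega>)"
proof -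
  interpret M: prob_space M by fact
  interpret M': prob_space M' by fact
  from assms(5) obtain U where
    "M.indep_vars (\<lambda>_. borel) U {1..}" "\<forall>j\<ge>1. AE \<omega> in M. 0 < U j \<omega>"
    "\<forall>j\<ge>1. \<forall>t\<ge>0. M.prob {\<omega>\<in>space M. U j \<omega> > t} = exp (- t)"
    "\<forall>t\<ge>0. \<forall>\<omega>\<in>space M. y t \<omega> = renewal_count U t \<omega>"
    unfolding M.standard_poisson_process_def M.renewal_counting_process_def by blast
  then interpret subordinated_renewal M \<beta> U y D
    using assms by unfold_locales auto
  from assms(8) obtain T where T:
    "M'.indep_vars (\<lambda>_. borel) T {1..}" "\<forall>j\<ge>1. AE \<omega> in M'. 0 < T j \<omega>"
    "\<forall>j\<ge>1. \<forall>t\<ge>0. M'.prob {\<omega>\<in>space M'. T j \<omega> > t} = mittag_leffler \<beta> (- (t powr \<beta>))"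
    "\<forall>t\<ge>0. \<forall>\<omega>\<in>space M'. x t \<omega> = renewal_count T t \<omega>"
    unfolding M'.fractional_poisson_process_def M'.renewal_counting_process_def by blast
  have T_meas[measurable]: "1 \<le> j \<Longrightarrow> M'.random_variable borel (T j)" for j
    using T(1) by (auto simp: M'.indep_vars_def)
  show ?thesis
  proof (rule equal_in_law_of_renewal)
    fix t :: real assume t: "0 \<le> t"
    have "(\<lambda>\<omega>. renewal_count T t \<omega>) \<in> measurable M' (count_space UNIV)"
      by (rule measurable_renewal_count) (auto simp: T_meas)
    then show "x t \<in> measurable M' (count_space UNIV)"
      using T(4) t by (subst measurable_cong) auto
    show "(\<lambda>\<omega>. y (inverse_process D t \<omega>) \<omega>) \<in> measurable M (count_space UNIV)"
      by (rule y_time_change_measurable[OF t])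
  next
    fix j :: nat assume j: "1 \<le> j"
    note [measurable] = T_meas[OF j]
    show "distr M' borel (T j) = distr M borel (W j)"
    \<comment> \<open>The sampled arguments are 2k: for k >= 1 they exceed 1, as both transform
      lemmas require, and k = 0 compares total masses.\<close>
    proof (rule laplace_transform_unique[where c = 2])
      show "AE x in distr M' borel (T j). 0 \<le> x"
        using T(2)[rule_format, OF j] by (subst AE_distr_iff) (auto elim: eventually_mono)
      show "AE x in distr M borel (W j). 0 \<le> x"
        using W_nonneg[OF j] by (subst AE_distr_iff) auto
      fix k :: nat
      show "(\<integral>x. exp (- (2 * real k * x)) \<partial>distr M' borel (T j)) = (\<integral>x. exp (- (2 * real k * x)) \<partial>distr M borel (W j))"
      proof -
        have "M'.expectation (\<lambda>\<omega>. exp (- (2 * real k * T j \<omega>))) = M.expectation (\<lambda>\<omega>. exp (- (2 * real k * W j \<omega>)))"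
        proof (cases "k = 0")
          case False
          then have "1 < 2 * real k" by (cases k) auto
          then show ?thesis
            using laplace_W[OF j, of "2 * real k"] M'.laplace_mittag_leffler[of "T j" \<beta> "2 * real k"] T j \<beta>
            by simp
        qed (simp add: M'.prob_space M.prob_space)
        then show ?thesis by (simp add: integral_distr)
      qed
    qed auto
  qed (use T W_indep AE_y_time_change assms in auto)
qed

end
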